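(* Let $E$ be an elliptic curve over $\mathbb{F}_q$ (with $\mathrm{char}\,\mathbb{F}_q\neq2,3$) with $E(\mathbb{F}_q)\cong\mathbb{Z}_{n_1}\oplus\mathbb{Z}_{n_2}$, where $1<n_1\mid n_2$, and let $n=n_1n_2-1$. Let $\{P_1,\dots,P_n\}=E(\mathbb{F}_q)\setminus\{O\}$, $D=P_1+\cdots+P_n$, $G=kO$ with $1\le k\le n-1$, and consider the $[n,k,n-k]$ code $\mathcal{C}=C_{\mathscr{L}}(D,G)$. Let $t\ge 1$. If $n_2\mid k$ and $(\mathbb{Z}_{n_1}\oplus\mathbb{Z}_{n_2},\mathcal{B}_k)$ is a $(t+1)$-$(n+1,k,\lambda_{t+1})$ design, then $(\{1,\dots,n\},\mathcal{H}_{n-k}(\mathcal{C}))$ is a $t$-$(n,n-k,\lambda_t)$ design for some $\lambda_t$.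
   Context: $O$ is the point at infinity (identity of the group $E(\mathbb{F}_q)$). $\mathcal{B}_k$ is the family of $k$-subsets of the group $\mathbb{Z}_{n_1}\oplus\mathbb{Z}_{n_2}$ whose elements sum to $0$. $\mathscr{L}(G)=\{f\in\mathbb{F}_q(E)^\times:\mathrm{div}(f)\ge -G\}\cup\{0\}$ and $C_{\mathscr{L}}(D,G)=\{(f(P_1),\dots,f(P_n)): f\in\mathscr{L}(G)\}$. $\mathcal{H}_{d}(\mathcal{C})$ is the set of distinct supports $\{i:c_i\neq0\}$ of codewords $c$ of minimum weight $d$. A $t$-$(v,k,\lambda)$ design is a family of distinct $k$-subsets of a $v$-set such that every $t$-subset lies in exactly $\lambda$ of them.
   Formalization: A t-(v,k,λ) design is taken with the usual requirement t ≤ k ≤ v, so t+1 ≤ k is assumed (and t ≤ n−k is proved); without it the claim fails, e.g. E(F_7) ≅ Z_3⊕Z_3, k=t=3, where B_3 is vacuously a 4-(9,3,0) design. *)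

theory Defs
  imports
    "HOL-Algebra.Algebraic_Closure_Type"
    "HOL-Algebra.Elementary_Groups"
    "HOL-Algebra.FiniteProduct"
    "HOL-Library.FuncSet"
begin

section \<open>Elliptic curves in short Weierstrass form\<close>

text \<open>The constructor \<open>Infinity\<close> is the point $O$.\<close>

datatype 'k ec_point = Infinity | Affine 'k 'k

definition ec_points :: "'k::field \<Rightarrow> 'k \<Rightarrow> 'k ec_point set" where
  "ec_points a b = insert Infinity {Affine x y | x y. y ^ 2 = x ^ 3 + a * x + b}"

definition ec_nonsingular :: "'k::field \<Rightarrow> 'k \<Rightarrow> bool" where
  "ec_nonsingular a b \<longleftrightarrow> 4 * a ^ 3 + 27 * b ^ 2 \<noteq> 0"

text \<open>Chord and tangent law. On the curve, \<open>x1 = x2\<close> together with \<open>y1 \<noteq> - y2\<close> forces the two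
  points to be equal with \<open>y1 \<noteq> 0\<close>, which is the tangent case.\<close>

fun ec_add :: "'k::field \<Rightarrow> 'k ec_point \<Rightarrow> 'k ec_point \<Rightarrow> 'k ec_point" where
  "ec_add a Infinity Q = Q"
| "ec_add a P Infinity = P"
| "ec_add a (Affine x1 y1) (Affine x2 y2) =
     (if x1 = x2 \<and> y1 = - y2 then Infinity
      else let m = (if x1 = x2 then (3 * x1 ^ 2 + a) / (2 * y1) else (y2 - y1) / (x2 - x1));
               x3 = m ^ 2 - x1 - x2
           in Affine x3 (m * (x1 - x3) - y1))"

definition ec_group :: "'k::field \<Rightarrow> 'k \<Rightarrow> 'k ec_point monoid" where
  "ec_group a b = \<lparr>carrier = ec_points a b, monoid.mult = ec_add a, one = Infinity\<rparr>"


section \<open>Function field, orders at points, Riemann-Roch spaces\<close>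

text \<open>The pair \<open>(u, v)\<close> of rational functions in \<open>x\<close> stands for \<open>u + v y\<close>, where
  \<open>y\<^sup>2 = x\<^sup>3 + a x + b\<close>; this is the function field of the curve as the quadratic extension
  \<open>k(x)(y)\<close> of \<open>k(x)\<close>.\<close>

type_synonym 'k ec_fun = "'k poly fract \<times> 'k poly fract"

definition ec_function_field :: "'k::field \<Rightarrow> 'k \<Rightarrow> 'k ec_fun ring" where
  "ec_function_field a b =
     \<lparr>carrier = UNIV,
      monoid.mult = (\<lambda>(u, v) (u', v'). (u * u' + v * v' * to_fract [:b, a, 0, 1:], u * v' + v * u')),
      one = (1, 0),
      zero = (0, 0),
      add = (\<lambda>(u, v) (u', v'). (u + u', v + v'))\<rparr>"

definition ec_const :: "'k::field \<Rightarrow> 'k ec_fun" where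
  "ec_const c = (to_fract [:c:], 0)"

definition ec_x :: "'k::field ec_fun" where
  "ec_x = (to_fract [:0, 1:], 0)"

definition ec_y :: "'k::field ec_fun" where
  "ec_y = (0, 1)"

text \<open>Normalized discrete valuations of the function field, trivial on the constants. The value
  $\infty$ at the zero function is not represented: valuations are only defined on nonzero
  functions (and \<open>undefined\<close> at zero, so that they are determined by their values).\<close>

definition ec_valuation :: "'k::field \<Rightarrow> 'k \<Rightarrow> ('k ec_fun \<Rightarrow> int) \<Rightarrow> bool" where
  "ec_valuation a b v \<longleftrightarrow>
     (let K = ec_function_field a b; N = carrier K - {\<zero>\<^bsub>K\<^esub>} in
        v \<in> extensional N \<and>
        (\<forall>f\<in>N. \<forall>g\<in>N. v (f \<otimes>\<^bsub>K\<^esub> g) = v f + v g) \<and>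
        (\<forall>f\<in>N. \<forall>g\<in>N. f \<oplus>\<^bsub>K\<^esub> g \<noteq> \<zero>\<^bsub>K\<^esub> \<longrightarrow> min (v f) (v g) \<le> v (f \<oplus>\<^bsub>K\<^esub> g)) \<and>
        (\<forall>c. c \<noteq> 0 \<longrightarrow> v (ec_const c) = 0) \<and>
        (\<exists>f\<in>N. v f = 1))"

text \<open>The centre of a valuation. Since \<open>O = [x/y : 1 : 1/y]\<close>, being centred at \<open>O\<close> means that
  \<open>x/y\<close> and \<open>1/y\<close> have positive valuation; the clauses below say this without dividing, and the
  disjunctions account for the value $\infty$ at the zero function.\<close>

fun ec_centred_at :: "'k::field \<Rightarrow> 'k \<Rightarrow> ('k ec_fun \<Rightarrow> int) \<Rightarrow> 'k ec_point \<Rightarrow> bool" where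
  "ec_centred_at a b v Infinity \<longleftrightarrow> v ec_y < v ec_x \<and> v ec_y < 0"
| "ec_centred_at a b v (Affine x0 y0) \<longleftrightarrow>
     (let K = ec_function_field a b;
          pos = (\<lambda>f. f = \<zero>\<^bsub>K\<^esub> \<or> 0 < v f)
      in pos (ec_x \<ominus>\<^bsub>K\<^esub> ec_const x0) \<and> pos (ec_y \<ominus>\<^bsub>K\<^esub> ec_const y0))"

text \<open>For a nonsingular curve over an algebraically closed field and a point on it there is exactly
  one such valuation; \<open>ec_ord a b P f\<close> is meaningful for nonzero \<open>f\<close> only.\<close>

definition ec_ord :: "'k::field \<Rightarrow> 'k \<Rightarrow> 'k ec_point \<Rightarrow> 'k ec_fun \<Rightarrow> int" where
  "ec_ord a b P = (THE v. ec_valuation a b v \<and> ec_centred_at a b v P)"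

text \<open>The value at \<open>P\<close> of a function that is regular there, i.e. its residue class.\<close>

definition ec_value :: "'k::field \<Rightarrow> 'k \<Rightarrow> 'k ec_fun \<Rightarrow> 'k ec_point \<Rightarrow> 'k" where
  "ec_value a b f P =
     (THE c. let K = ec_function_field a b; g = f \<ominus>\<^bsub>K\<^esub> ec_const c
             in g = \<zero>\<^bsub>K\<^esub> \<or> 0 < ec_ord a b P g)"

text \<open>Divisors are formal integer combinations of geometric points, written as coefficient
  functions.\<close>

type_synonym 'k ec_divisor = "'k ec_point \<Rightarrow> int"

definition ec_div :: "'k::field \<Rightarrow> 'k \<Rightarrow> 'k ec_fun \<Rightarrow> 'k ec_divisor" where
  "ec_div a b f = (\<lambda>P. if P \<in> ec_points a b then ec_ord a b P f else 0)"

definition point_divisor :: "'k ec_point \<Rightarrow> 'k ec_divisor" where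
  "point_divisor P = (\<lambda>Q. if Q = P then 1 else 0)"

text \<open>The function field over the base field \<open>F\<close>, inside the one over the algebraic closure:
  \<open>u + v y\<close> with \<open>u\<close>, \<open>v\<close> quotients of polynomials with coefficients in \<open>F\<close>.\<close>

definition base_ratfuns :: "'a::field alg_closure poly fract set" where
  "base_ratfuns =
     {to_fract (map_poly to_ac p) / to_fract (map_poly to_ac q) | (p :: 'a poly) q. q \<noteq> 0}"

definition base_ec_funs :: "'a::field alg_closure ec_fun set" where
  "base_ec_funs = base_ratfuns \<times> base_ratfuns"

text \<open>The curve has coefficients \<open>a\<close>, \<open>b\<close> in the base field; orders are taken at all points over
  the algebraic closure.\<close>

definition RR_space :: "'a::field \<Rightarrow> 'a \<Rightarrow> 'a alg_closure ec_divisor \<Rightarrow> 'a alg_closure ec_fun set"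
  where
  "RR_space a b G =
     {f \<in> base_ec_funs. f \<noteq> \<zero>\<^bsub>ec_function_field (to_ac a) (to_ac b)\<^esub> \<and>
        (\<forall>P. - G P \<le> ec_div (to_ac a) (to_ac b) f P)}
     \<union> {\<zero>\<^bsub>ec_function_field (to_ac a) (to_ac b)\<^esub>}"


section \<open>Algebraic geometry codes and their supports\<close>

text \<open>Words of length \<open>n\<close> are functions on \<open>{1..n}\<close>. The divisor \<open>D = P 1 + \<dots> + P n\<close> is given
  by the enumeration of its points.\<close>

definition ag_code ::
    "'a::field \<Rightarrow> 'a \<Rightarrow> nat \<Rightarrow> (nat \<Rightarrow> 'a ec_point) \<Rightarrow> 'a alg_closure ec_divisor \<Rightarrow> (nat \<Rightarrow> 'a) set"
  where
  "ag_code a b n P G =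
     {c \<in> extensional {1..n}. \<exists>f\<in>RR_space a b G. \<forall>i\<in>{1..n}.
        to_ac (c i) = ec_value (to_ac a) (to_ac b) f (map_ec_point to_ac (P i))}"

definition word_support :: "nat \<Rightarrow> (nat \<Rightarrow> 'a::zero) \<Rightarrow> nat set" where
  "word_support n c = {i \<in> {1..n}. c i \<noteq> 0}"

text \<open>Supports of the codewords of weight \<open>w\<close>.\<close>

definition code_supports :: "nat \<Rightarrow> nat \<Rightarrow> (nat \<Rightarrow> 'a::zero) set \<Rightarrow> nat set set" where
  "code_supports n w C = {word_support n c | c. c \<in> C \<and> card (word_support n c) = w}"


section \<open>Designs and zero-sum subsets\<close>

text \<open>The usual requirement \<open>t \<le> k \<le> v\<close> is included; \<open>\<lambda> = 0\<close> is allowed.\<close>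

definition t_design :: "nat \<Rightarrow> nat \<Rightarrow> nat \<Rightarrow> nat \<Rightarrow> 'p set \<Rightarrow> 'p set set \<Rightarrow> bool" where
  "t_design t v k l V Bs \<longleftrightarrow>
     finite V \<and> card V = v \<and> t \<le> k \<and> k \<le> v \<and>
     (\<forall>B\<in>Bs. B \<subseteq> V \<and> card B = k) \<and>
     (\<forall>T. T \<subseteq> V \<and> card T = t \<longrightarrow> card {B \<in> Bs. T \<subseteq> B} = l)"

definition zero_sum_subsets :: "('g, 'm) monoid_scheme \<Rightarrow> nat \<Rightarrow> 'g set set" where
  "zero_sum_subsets A k =
     {S. S \<subseteq> carrier A \<and> card S = k \<and> (\<Otimes>\<^bsub>A\<^esub>x\<in>S. x) = \<one>\<^bsub>A\<^esub>}"

end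

theory Submission
  imports Defs
begin

text \<open>
  Minimum-weight codewords come from functions with pole order at most $k$ at $O$ and $k$ distinct
  zeros among the rational points. Such a zero set sums to $O$, and every set of $k$ affine points
  summing to $O$ is such a zero set; hence the supports are the complements of the blocks of
  $\mathcal{B}_k$ that avoid $0$. In a $(t+1)$-design the number of blocks avoiding a given
  $(t+1)$-set is constant, which is the design property of these complements.

  Functions are treated inside the field \<open>'k poly fract alg_closure\<close>, which contains a square root
  of the cubic; products of maximal ideals of the coordinate ring replace divisors, and replacing
  two points by their sum through the line joining them proves the zero-sum criterion by induction.
  Associativity of the group law on rational points is inherited from the isomorphism in the
  hypotheses. Orders at affine points come from a local parameter, the order at $O$ is minus the
  degree of the norm.
\<close>

section \<open>Designs and zero-sum subsets\<close>

text \<open>The shape of the proof comes from the definitions. \<open>ec_ord\<close> and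
  \<open>ec_value\<close> are definite descriptions, so they say nothing until a valuation with the
  given centre has been exhibited and shown to be the only one; this is done from the Weierstrass
  equation. The algebraic closure of k(x) is chosen as ambient type because it is already a field:
  the function field becomes a subset of it, and ordinary ring simplification applies. Geometric
  points are what forces a function with no pole outside O to be a polynomial in x and y, since a
  function over the base field may have its poles at nonrational points. Once this is known, the
  argument returns to the base field. A second obstacle is the clause in \<open>t_design\<close>
  that the strength is at most the block size: it now reads t <= n - k, which t + 1 <= k does not
  give. It is obtained because the zero-sum family is neither empty nor complete; nonemptiness rests
  on the fact that in a product of two cyclic groups at most four elements have a given
  double.\<close>

lemma t_design_count_step:
  assumes V: "finite V" and Bs: "\<forall>B\<in>Bs. B \<subseteq> V \<and> card B = k" and I: "I \<subseteq> V" "card I < k"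
    and c: "\<And>x. x \<in> V - I \<Longrightarrow> card {B \<in> Bs. insert x I \<subseteq> B} = c"
  shows "card {B \<in> Bs. I \<subseteq> B} = (card V - card I) * c div (k - card I)"
proof -
  have finI: "finite I" using V I finite_subset by blast
  have fin: "finite {B \<in> Bs. I \<subseteq> B}" by (rule finite_subset[of _ "Pow V"]) (use V Bs in auto)
  \<comment> \<open>Double counting of the pairs (x, B) with x outside \<open>I\<close> and
    \<open>insert x I\<close> contained in B: every x lies in \<open>c\<close> pairs, every block
    containing \<open>I\<close> in \<open>k - card I\<close>.\<close>
  have "(card V - card I) * c = (\<Sum>x\<in>V - I. card {B \<in> Bs. insert x I \<subseteq> B})"
    using c V I finI by (simp add: card_Diff_subset)
  also have "\<dots> = (\<Sum>x\<in>V - I. card {B \<in> {B \<in> Bs. I \<subseteq> B}. x \<in> B})"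
    by (intro sum.cong arg_cong[of _ _ card]) auto
  also have "\<dots> = (\<Sum>x\<in>V - I. \<Sum>B\<in>{B \<in> Bs. I \<subseteq> B}. if x \<in> B then 1 else 0)"
    using fin by (intro sum.cong) (auto simp: sum.If_cases Int_def)
  also have "\<dots> = (\<Sum>B\<in>{B \<in> Bs. I \<subseteq> B}. \<Sum>x\<in>V - I. if x \<in> B then 1 else 0)"
    by (rule sum.swap)
  also have "\<dots> = (\<Sum>B\<in>{B \<in> Bs. I \<subseteq> B}. k - card I)"
  proof (rule sum.cong[OF refl])
    fix B assume B: "B \<in> {B \<in> Bs. I \<subseteq> B}"
    have "(\<Sum>x\<in>V - I. if x \<in> B then 1 else 0) = card ((V - I) \<inter> {x. x \<in> B})"
      using V by (simp add: sum.If_cases)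
    also have "(V - I) \<inter> {x. x \<in> B} = B - I" using B Bs by auto
    also have "card (B - I) = k - card I" using B Bs finI by (simp add: card_Diff_subset)
    finally show "(\<Sum>x\<in>V - I. if x \<in> B then 1 else 0) = k - card I" .
  qed
  finally have "(card V - card I) * c = card {B \<in> Bs. I \<subseteq> B} * (k - card I)" by simp
  thus ?thesis using I(2) by simp
qed

text \<open>Downward induction from strength T, each step being the double count above. Only
  constancy matters, so the value stays unnamed; i < T <= k keeps the divisor \<open>k - i\<close>
  positive.\<close>

lemma t_design_count_containing:
  assumes D: "t_design T v k l V Bs" and "i \<le> T"
  shows "\<exists>c. \<forall>I. I \<subseteq> V \<and> card I = i \<longrightarrow> card {B \<in> Bs. I \<subseteq> B} = c"
  using assms(2)
proof (induction i rule: inc_induct)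
  case base
  thus ?case using D by (auto simp: t_design_def)
next
  case (step i)
  then obtain c where c: "\<forall>I. I \<subseteq> V \<and> card I = Suc i \<longrightarrow> card {B \<in> Bs. I \<subseteq> B} = c" by blast
  have V: "finite V" and Bs: "\<forall>B\<in>Bs. B \<subseteq> V \<and> card B = k" and "T \<le> k"
    using D by (auto simp: t_design_def)
  have "card {B \<in> Bs. I \<subseteq> B} = (card V - i) * c div (k - i)" if I: "I \<subseteq> V" "card I = i" for I
  proof -
    have "finite I" using V I finite_subset by blast
    hence "card {B \<in> Bs. insert x I \<subseteq> B} = c" if "x \<in> V - I" for x
      using c[rule_format, of "insert x I"] that I by auto
    moreover have "card I < k" using I step(2) \<open>T \<le> k\<close> by linarith
    ultimately show ?thesis using t_design_count_step[OF V Bs I(1), of c] I(2) by blast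
  qed
  thus ?case by blast
qed

text \<open>For $x \in J$, the blocks avoiding $J$ are those avoiding $J \setminus \{x\}$ except the ones
  through $x$.\<close>

lemma t_design_count:
  assumes D: "t_design T v k l V Bs" and "i + j \<le> T"
  shows "\<exists>c. \<forall>I J. I \<subseteq> V \<and> J \<subseteq> V \<and> I \<inter> J = {} \<and> card I = i \<and> card J = j \<longrightarrow>
    card {B \<in> Bs. I \<subseteq> B \<and> B \<inter> J = {}} = c"
  using assms(2)
proof (induction j arbitrary: i)
  case 0
  have V: "finite V" using D by (auto simp: t_design_def)
  obtain c where c: "\<forall>I. I \<subseteq> V \<and> card I = i \<longrightarrow> card {B \<in> Bs. I \<subseteq> B} = c"
    using t_design_count_containing[OF D, of i] 0 by auto
  have J: "J = {}" if "J \<subseteq> V" "card J = 0" for J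
    using that V by (meson card_0_eq finite_subset)
  have count: "card {B \<in> Bs. I \<subseteq> B \<and> B \<inter> J = {}} = c"
    if "I \<subseteq> V" "J \<subseteq> V" "card I = i" "card J = 0" for I J
    using c that(1,3) unfolding J[OF that(2,4)] by simp
  show ?case by (intro exI allI impI, elim conjE) (rule count)
next
  case (Suc j)
  have V: "finite V" and Bs: "\<forall>B\<in>Bs. B \<subseteq> V \<and> card B = k" using D by (auto simp: t_design_def)
  have fin: "finite Bs" by (rule finite_subset[of _ "Pow V"]) (use V Bs in auto)
  obtain c where c: "\<forall>I J. I \<subseteq> V \<and> J \<subseteq> V \<and> I \<inter> J = {} \<and> card I = i \<and> card J = j \<longrightarrow>
    card {B \<in> Bs. I \<subseteq> B \<and> B \<inter> J = {}} = c" using Suc.IH[of i] Suc.prems by auto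
  obtain d where d: "\<forall>I J. I \<subseteq> V \<and> J \<subseteq> V \<and> I \<inter> J = {} \<and> card I = Suc i \<and> card J = j \<longrightarrow>
    card {B \<in> Bs. I \<subseteq> B \<and> B \<inter> J = {}} = d" using Suc.IH[of "Suc i"] Suc.prems by auto
  have count: "card {B \<in> Bs. I \<subseteq> B \<and> B \<inter> J = {}} = c - d"
    if IJ: "I \<subseteq> V" "J \<subseteq> V" "I \<inter> J = {}" "card I = i" "card J = Suc j" for I J
  proof -
    obtain x J' where J: "J = insert x J'" "x \<notin> J'" "card J' = j"
      using IJ(5) by (metis card_Suc_eq)
    have finI: "finite I" using V IJ finite_subset by blast
    have sub: "insert x I \<subseteq> V" "J' \<subseteq> V" "insert x I \<inter> J' = {}" "I \<inter> J' = {}" "x \<notin> I"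
      using IJ(1-3) J(2) unfolding J(1) by blast+
    have cI: "card (insert x I) = Suc i" using finI sub(5) IJ(4) by simp
    let ?N = "\<lambda>I J. {B \<in> Bs. I \<subseteq> B \<and> B \<inter> J = {}}"
    have "?N I J' = ?N I J \<union> ?N (insert x I) J'" unfolding J(1) by blast
    moreover have "card (?N I J \<union> ?N (insert x I) J') = card (?N I J) + card (?N (insert x I) J')"
      unfolding J(1) by (rule card_Un_disjoint) (use fin in auto)
    moreover have "card (?N (insert x I) J') = d"
      by (rule d[rule_format, OF conjI[OF sub(1) conjI[OF sub(2) conjI[OF sub(3) conjI[OF cI J(3)]]]]])
    moreover have "card (?N I J') = c"
      by (rule c[rule_format, OF conjI[OF IJ(1) conjI[OF sub(2) conjI[OF sub(4) conjI[OF IJ(4) J(3)]]]]])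
    ultimately show ?thesis by simp
  qed
  show ?case by (intro exI allI impI, elim conjE) (rule count)
qed

text \<open>For a k-set S, the only block that can avoid \<open>V - S\<close> is S itself, so the
  number of such blocks is 1 or 0. Strength at least v - k makes this number independent of S, and
  one existing block makes it 1.\<close>

lemma t_design_all_subsets:
  assumes D: "t_design T v k l V Bs" and "v - k \<le> T" "Bs \<noteq> {}" and S: "S \<subseteq> V" "card S = k"
  shows "S \<in> Bs"
proof -
  have V: "finite V" "card V = v" and Bs: "\<forall>B\<in>Bs. B \<subseteq> V \<and> card B = k" using D by (auto simp: t_design_def)
  have fin: "finite Bs" by (rule finite_subset[of _ "Pow V"]) (use V Bs in auto)
  obtain c where c: "\<forall>I J. I \<subseteq> V \<and> J \<subseteq> V \<and> I \<inter> J = {} \<and> card I = 0 \<and> card J = v - k \<longrightarrow>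
    card {B \<in> Bs. I \<subseteq> B \<and> B \<inter> J = {}} = c" using t_design_count[OF D, of 0 "v - k"] assms(2) by auto
  have cc: "card {B \<in> Bs. B \<inter> (V - S) = {}} = c" if "S \<subseteq> V" "card S = k" for S
    using c[rule_format, of "{}" "V - S"] that V by (simp add: card_Diff_subset finite_subset)
  obtain B where B: "B \<in> Bs" using assms(3) by blast
  have "B \<in> {B' \<in> Bs. B' \<inter> (V - B) = {}}" using B by auto
  hence "0 < card {B' \<in> Bs. B' \<inter> (V - B) = {}}" using fin by (auto simp: card_gt_0_iff)
  hence "0 < c" using cc[of B] B Bs by simp
  hence "{B \<in> Bs. B \<inter> (V - S) = {}} \<noteq> {}" using cc[OF S] by (metis card.empty less_irrefl)
  then obtain B' where B': "B' \<in> Bs" "B' \<inter> (V - S) = {}" by blast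
  hence "B' \<subseteq> S" using Bs by blast
  hence "B' = S" using Bs B' S V by (metis card_subset_eq finite_subset)
  thus ?thesis using B' by simp
qed

text \<open>The set to be avoided is \<open>x0\<close> together with the image of a t-set, which is
  where one unit of strength is spent. In the application \<open>x0\<close> is the identity of the
  group and \<phi> numbers the other elements.\<close>

lemma t_design_complement_residual:
  assumes D: "t_design (t + 1) (n + 1) k l V Bs" and x0: "x0 \<in> V"
    and \<phi>: "bij_betw \<phi> {1..n} (V - {x0})" and tn: "t \<le> n - k"
  shows "\<exists>mu. t_design t n (n - k) mu {1..n} {{i \<in> {1..n}. \<phi> i \<notin> B} | B. B \<in> Bs \<and> x0 \<notin> B}"
proof -
  let ?V = "{1..n}" and ?c = "\<lambda>B. {i \<in> {1..n}. \<phi> i \<notin> B}"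
  have V: "finite V" "card V = n + 1" and Bs: "\<forall>B\<in>Bs. B \<subseteq> V \<and> card B = k"
    using D by (auto simp: t_design_def)
  have im: "\<phi> ` ?V = V - {x0}" and inj: "inj_on \<phi> ?V" using \<phi> by (auto simp: bij_betw_def)
  obtain c where c: "\<forall>I J. I \<subseteq> V \<and> J \<subseteq> V \<and> I \<inter> J = {} \<and> card I = 0 \<and> card J = t + 1 \<longrightarrow>
    card {B \<in> Bs. I \<subseteq> B \<and> B \<inter> J = {}} = c" using t_design_count[OF D, of 0 "t + 1"] by auto
  have comp: "\<phi> ` ?c B = (V - {x0}) - B" for B unfolding im[symmetric] by blast
  have card: "card (?c B) = n - k" if B: "B \<in> Bs" "x0 \<notin> B" for B
  proof -
    have "card (?c B) = card (\<phi> ` ?c B)" using inj by (metis (no_types, lifting) card_image inj_on_subset mem_Collect_eq subsetI)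
    also have "\<dots> = card ((V - {x0}) - B)" unfolding comp ..
    also have "\<dots> = card (V - {x0}) - card B"
      using B Bs V by (intro card_Diff_subset) (auto intro: finite_subset)
    finally show ?thesis using B Bs V x0 by simp
  qed
  \<comment> \<open>The new design counts distinct complements, while the known count is one of
    blocks; a block avoiding \<open>x0\<close> is recovered from its complement.\<close>
  have inj_c: "inj_on ?c {B \<in> Bs. x0 \<notin> B}"
  proof (rule inj_onI)
    fix B B' assume B: "B \<in> {B \<in> Bs. x0 \<notin> B}" "B' \<in> {B \<in> Bs. x0 \<notin> B}" and eq: "?c B = ?c B'"
    have "\<phi> ` ?c B = \<phi> ` ?c B'" unfolding eq ..
    hence "(V - {x0}) - B = (V - {x0}) - B'" unfolding comp .
    thus "B = B'" using B Bs by blast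
  qed
  have count: "card {C \<in> {?c B | B. B \<in> Bs \<and> x0 \<notin> B}. T \<subseteq> C} = c" if T: "T \<subseteq> ?V" "card T = t" for T
  proof -
    have "{C \<in> {?c B | B. B \<in> Bs \<and> x0 \<notin> B}. T \<subseteq> C} = ?c ` {B \<in> Bs. B \<inter> insert x0 (\<phi> ` T) = {}}"
      using T(1) by auto
    also have "card \<dots> = card {B \<in> Bs. B \<inter> insert x0 (\<phi> ` T) = {}}"
      by (rule card_image, rule inj_on_subset[OF inj_c]) auto
    also have "\<dots> = c"
    proof -
      have "card (\<phi> ` T) = t" using T inj by (metis card_image inj_on_subset)
      moreover have "\<phi> ` T \<subseteq> V - {x0}" using T im by blast
      moreover have "x0 \<notin> \<phi> ` T" using T im by blast
      moreover have "finite (\<phi> ` T)" using T(1) by (meson finite_atLeastAtMost finite_imageI finite_subset)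
      ultimately show ?thesis using c[rule_format, of "{}" "insert x0 (\<phi> ` T)"] x0
        by (auto simp: card_insert_if)
    qed
    finally show ?thesis .
  qed
  show ?thesis
    unfolding t_design_def using tn card count by (intro exI[of _ c]) auto
qed

section \<open>Zero-sum subsets of a finite abelian group\<close>

lemma (in comm_group) exists_zero_sum_subset:
  assumes fin: "finite (carrier G)" and two_torsion: "\<And>s. card {w \<in> carrier G. w \<otimes> w = s} \<le> 4"
    and k: "card (carrier G) = k + m" "m < k" "2 \<le> m"
  shows "zero_sum_subsets G k \<noteq> {}"
proof -
  \<comment> \<open>A k-subset has product one exactly if its complement, of size m, has the product
    \<sigma> of the whole group. Such an m-set is built from m - 2 arbitrary elements
    \<open>U\<close> and two distinct elements outside \<open>U\<close> with the missing product
    \<open>s\<close>.\<close>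
  define \<sigma> where "\<sigma> = (\<Otimes>x\<in>carrier G. x)"
  have fp: "(\<Otimes>x\<in>A. x) \<in> carrier G" if "A \<subseteq> carrier G" for A using that by (intro finprod_closed) auto
  have \<sigma>: "\<sigma> \<in> carrier G" unfolding \<sigma>_def by (rule fp) simp
  have "m - 2 \<le> card (carrier G)" using k by simp
  then obtain U where U: "U \<subseteq> carrier G" "card U = m - 2" "finite U"
    by (rule obtain_subset_with_card_n)
  define s where "s = \<sigma> \<otimes> inv (\<Otimes>x\<in>U. x)"
  have s: "s \<in> carrier G" "(\<Otimes>x\<in>U. x) \<otimes> s = \<sigma>"
    using \<sigma> fp[OF U(1)] by (simp_all add: s_def m_lcomm[of "finprod G (\<lambda>x. x) U"])
  define W where "W = carrier G - U"
  have W: "card W = k + 2" "finite W" "W \<subseteq> carrier G" using U k fin by (auto simp: W_def card_Diff_subset)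
  \<comment> \<open>The involution pairing w with the element completing it to \<open>s\<close>; its
    fixed points are the w with w \<otimes> w = s.\<close>
  let ?f = "\<lambda>w. s \<otimes> inv w"
  have inj: "inj_on ?f (carrier G)" using s by (auto intro!: inj_onI)
  have "card (?f ` W) = k + 2" using W inj by (metis card_image inj_on_subset)
  moreover have fW: "?f ` W \<subseteq> carrier G" using W s by auto
  moreover have "card (W \<union> ?f ` W) \<le> k + m" using fW W fin k by (metis Un_subset_iff card_mono)
  moreover have "card W + card (?f ` W) = card (W \<union> ?f ` W) + card (W \<inter> ?f ` W)"
    using W by (intro card_Un_Int) auto
  \<comment> \<open>Two sets of size k + 2 in a group of order k + m share at least k + 4 - m
    elements. By m < k this is at least 5, one more than the possible fixed points.\<close>
  ultimately have "5 \<le> card (W \<inter> ?f ` W)" using W k by linarith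
  moreover have "card {w \<in> carrier G. w \<otimes> w = s} \<le> 4" by (rule two_torsion)
  ultimately have "\<not> W \<inter> ?f ` W \<subseteq> {w \<in> carrier G. w \<otimes> w = s}"
    using fin card_mono[of "{w \<in> carrier G. w \<otimes> w = s}" "W \<inter> ?f ` W"] by auto
  then obtain w w' where w: "w \<in> W" "w' \<in> W" "w = s \<otimes> inv w'" "w \<otimes> w \<noteq> s" using W by auto
  have wG: "w \<in> carrier G" "w' \<in> carrier G" using w W by auto
  have ww: "w \<otimes> w' = s" unfolding w(3) using wG s by (simp add: m_assoc)
  hence ne: "w \<noteq> w'" using w by auto
  define S where "S = carrier G - insert w (insert w' U)"
  have wU: "w \<notin> U" "w' \<notin> U" using w by (auto simp: W_def)
  have C: "insert w (insert w' U) \<subseteq> carrier G" "finite (insert w (insert w' U))"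
    "card (insert w (insert w' U)) = m" using wG U wU ne k by auto
  have "(\<Otimes>x\<in>insert w (insert w' U). x) = w \<otimes> (w' \<otimes> (\<Otimes>x\<in>U. x))"
    using U wU ne wG by (subst finprod_insert; auto)+
  also have "\<dots> = \<sigma>" using s ww wG fp[OF U(1)] by (metis m_assoc m_comm)
  finally have Csum: "(\<Otimes>x\<in>insert w (insert w' U). x) = \<sigma>" .
  have "\<sigma> = (\<Otimes>x\<in>S \<union> insert w (insert w' U). x)"
    unfolding \<sigma>_def S_def using C by (intro arg_cong[of _ _ "finprod G (\<lambda>x. x)"]) auto
  also have "\<dots> = (\<Otimes>x\<in>S. x) \<otimes> \<sigma>"
    using finprod_Un_disjoint[of S "insert w (insert w' U)" "\<lambda>x. x"] C fin Csum by (auto simp: S_def)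
  finally have "(\<Otimes>x\<in>S. x) = \<one>" using \<sigma> fp[of S] r_cancel_one'[of \<sigma> "\<Otimes>x\<in>S. x"] by (auto simp: S_def)
  moreover have "card S = k" using C k fin by (simp add: S_def card_Diff_subset)
  ultimately have "S \<in> zero_sum_subsets G k" by (auto simp: zero_sum_subsets_def S_def)
  thus ?thesis by auto
qed

text \<open>Exchanging one element of a set changes its product, so of two k-sets with k - 1 common
  elements at most one has product one.\<close>

lemma (in comm_group) exists_nonzero_sum_subset:
  assumes fin: "finite (carrier G)" and k: "1 \<le> k" "k < card (carrier G)"
  obtains S where "S \<subseteq> carrier G" "card S = k" "S \<notin> zero_sum_subsets G k"
proof -
  have "k - 1 \<le> card (carrier G)" using k by simp
  then obtain U where U: "U \<subseteq> carrier G" "card U = k - 1" "finite U"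
    by (rule obtain_subset_with_card_n)
  have "2 \<le> card (carrier G - U)" using U k by (simp add: card_Diff_subset)
  hence "\<not> card (carrier G - U) \<le> Suc 0" by simp
  then obtain x y where xy: "x \<in> carrier G - U" "y \<in> carrier G - U" "x \<noteq> y"
    using card_le_Suc0_iff_eq[OF finite_Diff[OF fin], of U] by blast
  have fp: "(\<Otimes>x\<in>U. x) \<in> carrier G" using U by (intro finprod_closed) auto
  have ins: "(\<Otimes>x\<in>insert z U. x) = z \<otimes> (\<Otimes>x\<in>U. x)" "card (insert z U) = k" if "z \<in> carrier G - U" for z
  proof -
    show "(\<Otimes>x\<in>insert z U. x) = z \<otimes> (\<Otimes>x\<in>U. x)" using U that by (subst finprod_insert) auto
    show "card (insert z U) = k" using U that k by simp
  qed
  have "x \<otimes> (\<Otimes>x\<in>U. x) \<noteq> y \<otimes> (\<Otimes>x\<in>U. x)" using xy fp by simp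
  hence "insert x U \<notin> zero_sum_subsets G k \<or> insert y U \<notin> zero_sum_subsets G k"
    using ins xy by (auto simp: zero_sum_subsets_def)
  moreover have "insert x U \<subseteq> carrier G" "insert y U \<subseteq> carrier G" using xy U by auto
  ultimately show ?thesis using that ins(2)[OF xy(1)] ins(2)[OF xy(2)] by metis
qed

text \<open>If $t > n - k$, the complements of the blocks would be an $m$-design with blocks of size
  $m = n + 1 - k$, so either every or no $k$-subset would sum to zero.\<close>

lemma (in comm_group) zero_sum_design_bound:
  assumes fin: "finite (carrier G)" and two_torsion: "\<And>s. card {w \<in> carrier G. w \<otimes> w = s} \<le> 4"
    and D: "t_design (t + 1) (n + 1) k l (carrier G) (zero_sum_subsets G k)"
    and k: "1 \<le> k" "k \<le> n - 1"
  shows "t \<le> n - k"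
proof (rule ccontr)
  assume "\<not> t \<le> n - k"
  hence t: "n + 1 - k \<le> t" by simp
  have card: "card (carrier G) = n + 1" "t + 1 \<le> k" using D by (auto simp: t_design_def)
  \<comment> \<open>With m = n + 1 - k, the negated claim m <= t and t + 1 <= k give m < k, while k
    <= n - 1 gives 2 <= m.\<close>
  have "zero_sum_subsets G k \<noteq> {}"
    using card t k by (intro exists_zero_sum_subset[OF fin two_torsion, where m = "n + 1 - k"]) auto
  moreover have "k < card (carrier G)" using card k by linarith
  then obtain S where "S \<subseteq> carrier G" "card S = k" "S \<notin> zero_sum_subsets G k"
    by (rule exists_nonzero_sum_subset[OF fin k(1)])
  ultimately show False using t_design_all_subsets[OF D] t by auto
qed

text \<open>Dividing w + w by n leaves the remainder s and a quotient 0 or 1, and quotient and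
  remainder together determine w.\<close>

lemma card_integer_mod_double:
  assumes "0 < n"
  shows "card {w \<in> carrier (integer_mod_group n). w \<otimes>\<^bsub>integer_mod_group n\<^esub> w = s} \<le> 2"
proof -
  let ?A = "{w \<in> carrier (integer_mod_group n). w \<otimes>\<^bsub>integer_mod_group n\<^esub> w = s}"
  let ?q = "\<lambda>w. (w + w) div int n"
  have A: "0 \<le> w \<and> w < int n \<and> w + w = int n * ?q w + s" if "w \<in> ?A" for w
    using that assms mult_div_mod_eq[of "int n" "w + w"] by (auto simp: carrier_integer_mod_group)
  have "inj_on ?q ?A"
  proof (rule inj_onI)
    fix w w' assume *: "w \<in> ?A" "w' \<in> ?A" "?q w = ?q w'"
    show "w = w'" using A[OF *(1)] A[OF *(2)] *(3) by simp
  qed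
  moreover have "?q ` ?A \<subseteq> {0, 1}"
  proof
    fix j assume "j \<in> ?q ` ?A"
    then obtain w where w: "w \<in> ?A" "j = ?q w" by blast
    have "0 \<le> j" using A[OF w(1)] w(2) assms by (simp add: pos_imp_zdiv_nonneg_iff)
    moreover have "j < 2"
    proof (rule ccontr)
      assume "\<not> j < 2"
      hence "int n * 2 \<le> int n * j" by (intro mult_left_mono) auto
      also have "\<dots> \<le> w + w"
        unfolding w(2)
        using mult_div_mod_eq[of "int n" "w + w"] pos_mod_sign[of "int n" "w + w"] assms by linarith
      finally show False using A[OF w(1)] by linarith
    qed
    ultimately show "j \<in> {0, 1}" by auto
  qed
  ultimately have "card ?A \<le> card {0, 1 :: int}" by (intro card_inj_on_le) auto
  thus ?thesis by simp
qed

lemma card_integer_mod_prod_double: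
  assumes "0 < n1" "0 < n2"
  shows "card {w \<in> carrier (integer_mod_group n1 \<times>\<times> integer_mod_group n2).
    w \<otimes>\<^bsub>integer_mod_group n1 \<times>\<times> integer_mod_group n2\<^esub> w = s} \<le> 4" (is "card ?A \<le> 4")
proof -
  let ?B = "\<lambda>n s. {w \<in> carrier (integer_mod_group n). w \<otimes>\<^bsub>integer_mod_group n\<^esub> w = s}"
  have "finite (?B n s)" if "0 < n" for n s
    by (rule finite_subset[of _ "{0..<int n}"]) (use that in \<open>auto simp: carrier_integer_mod_group\<close>)
  hence "card ?A \<le> card (?B n1 (fst s) \<times> ?B n2 (snd s))"
    using assms by (intro card_mono) (auto simp: mult_DirProd')
  also have "\<dots> \<le> 2 * 2"
    unfolding card_cartesian_product by (intro mult_le_mono card_integer_mod_double assms)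
  finally show ?thesis by simp
qed

section \<open>The coordinate ring of the curve\<close>

definition emb :: "'k::field poly \<Rightarrow> 'k poly fract alg_closure" where
  "emb p = to_ac (to_fract p)"

lemma emb_simps [simp]:
  "emb 0 = 0" "emb 1 = 1" "emb (p + q) = emb p + emb q" "emb (p - q) = emb p - emb q"
  "emb (- p) = - emb p" "emb (p * q) = emb p * emb q" "emb p = emb q \<longleftrightarrow> p = q"
  "emb p = 0 \<longleftrightarrow> p = 0"
  by (simp_all add: emb_def)

lemma emb_power [simp]: "emb (p ^ n) = emb p ^ n"
  by (induction n) simp_all

text \<open>A locale, because the theory is used for two fields: the base field, where the code
  lives, and its algebraic closure, where the orders are taken.\<close>

locale weierstrass =
  fixes a b :: "'k::field"
  assumes two: "(2::'k) \<noteq> 0" and nonsingular: "ec_nonsingular a b"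
begin

definition cubic :: "'k poly" where "cubic = [:b, a, 0, 1:]"

lemma degree_cubic [simp]: "degree cubic = 3" and cubic_nonzero [simp]: "cubic \<noteq> 0"
  by (simp_all add: cubic_def)

text \<open>Either square root will do: every later fact rests on \<open>Y_sq\<close> alone.\<close>

definition Y :: "'k poly fract alg_closure" where
  "Y = (SOME z. z ^ 2 = emb cubic)"

lemma Y_sq: "Y ^ 2 = emb cubic"
  unfolding Y_def by (rule someI_ex) (rule nth_root_exists, simp)

lemma Y_mult_Y: "Y * Y = emb cubic"
  using Y_sq by (simp add: power2_eq_square)

lemma poly_cubic: "poly cubic x = x ^ 3 + a * x + b"
  by (simp add: cubic_def algebra_simps power3_eq_cube)

definition ffun :: "'k ec_fun \<Rightarrow> 'k poly fract alg_closure" where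
  "ffun f = to_ac (fst f) + to_ac (snd f) * Y"

text \<open>The two degrees differ in parity. Hence the cubic is not a square in k(x), so 1 and
  \<open>Y\<close> are independent over k(x) and \<open>ffun\<close> is injective.\<close>

lemma odd_degree_cubic: "u * u \<noteq> v * v * cubic" if "v \<noteq> 0" for u v :: "'k poly"
proof
  assume *: "u * u = v * v * cubic"
  with that have "u \<noteq> 0" by auto
  hence "degree (u * u) = 2 * degree u" by (simp add: degree_mult_eq)
  moreover have "degree (v * v * cubic) = 2 * degree v + 3"
    using that by (subst degree_mult_eq) (auto simp: degree_mult_eq)
  ultimately have "2 * degree u = 2 * degree v + 3" using * by simp
  thus False by presburger
qed

lemma ffun_eq_0_iff: "ffun f = 0 \<longleftrightarrow> f = (0, 0)"
proof
  assume *: "ffun f = 0"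
  obtain u v where f: "f = (u, v)" by fastforce
  show "f = (0, 0)"
  proof (cases "v = 0")
    case True
    then show ?thesis using * by (simp add: ffun_def f)
  next
    case False
    obtain p q where u: "u = Fract p q" "q \<noteq> 0" by (cases u) auto
    obtain p' q' where v: "v = Fract p' q'" "q' \<noteq> 0" by (cases v) auto
    have "p' \<noteq> 0" using False v by (auto simp: fract_collapse)
    have "to_ac u = - (to_ac v * Y)" using * by (simp add: ffun_def f add_eq_0_iff)
    hence "to_ac u * to_ac u = to_ac v * to_ac v * (Y * Y)" by (simp add: algebra_simps)
    hence "to_ac (u * u) = to_ac (v * v * to_fract cubic)"
      by (simp add: Y_mult_Y emb_def)
    hence "u * u = v * v * to_fract cubic" by (simp only: to_ac_eq_iff)
    hence "p * p * (q' * q') = p' * p' * cubic * (q * q)"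
      unfolding u v to_fract_def using u(2) v(2) by (simp only: mult_fract eq_fract mult_eq_0_iff one_neq_zero) (simp only: eq_fract mult_eq_0_iff simp_thms one_neq_zero mult_1_right)
    hence "(p * q') * (p * q') = (p' * q) * (p' * q) * cubic" by (simp only: mult_ac)
    moreover have "p' * q \<noteq> 0" using \<open>p' \<noteq> 0\<close> u by simp
    ultimately show ?thesis using odd_degree_cubic by blast
  qed
qed (simp add: ffun_def)

lemma ffun_add: "ffun f + ffun g = ffun (fst f + fst g, snd f + snd g)"
  and ffun_diff: "ffun f - ffun g = ffun (fst f - fst g, snd f - snd g)"
  and ffun_uminus: "- ffun f = ffun (- fst f, - snd f)"
  by (simp_all add: ffun_def algebra_simps)

lemma ffun_mult: "ffun f * ffun g =
  ffun (fst f * fst g + snd f * snd g * to_fract cubic, fst f * snd g + snd f * fst g)"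
proof -
  have "ffun f * ffun g = to_ac (fst f) * to_ac (fst g) + to_ac (snd f) * to_ac (snd g) * (Y * Y)
      + (to_ac (fst f) * to_ac (snd g) + to_ac (snd f) * to_ac (fst g)) * Y"
    by (simp add: ffun_def algebra_simps)
  thus ?thesis unfolding Y_mult_Y by (simp add: ffun_def emb_def)
qed

lemma inj_ffun: "inj ffun"
proof (rule injI)
  fix f g assume "ffun f = ffun g"
  hence "ffun (fst f - fst g, snd f - snd g) = 0" by (simp flip: ffun_diff)
  thus "f = g" by (simp add: ffun_eq_0_iff prod_eq_iff)
qed

lemma ffun_eq_iff [simp]: "ffun f = ffun g \<longleftrightarrow> f = g"
  using inj_ffun by (auto dest: injD)

definition el :: "'k poly \<Rightarrow> 'k poly \<Rightarrow> 'k poly fract alg_closure" where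
  "el u v = emb u + emb v * Y"

lemma el_conv_ffun: "el u v = ffun (to_fract u, to_fract v)"
  by (simp add: el_def ffun_def emb_def)

definition R :: "'k poly fract alg_closure set" where
  "R = range (\<lambda>(u, v). el u v)"

lemma el_in_R [simp, intro]: "el u v \<in> R"
  unfolding R_def by force

lemma R_cases: assumes "z \<in> R" obtains u v where "z = el u v"
  using assms by (auto simp: R_def)

lemma el_eq_iff [simp]: "el u v = el u' v' \<longleftrightarrow> u = u' \<and> v = v'"
  by (simp add: el_conv_ffun)

lemma el_eq_0_iff [simp]: "el u v = 0 \<longleftrightarrow> u = 0 \<and> v = 0"
  by (simp add: el_conv_ffun ffun_eq_0_iff)

lemma el_add: "el u v + el u' v' = el (u + u') (v + v')"
  and el_diff: "el u v - el u' v' = el (u - u') (v - v')"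
  and el_uminus: "- el u v = el (- u) (- v)"
  by (simp_all add: el_def algebra_simps)

lemma el_mult: "el u v * el u' v' = el (u * u' + v * v' * cubic) (u * v' + v * u')"
  by (simp add: el_conv_ffun ffun_mult)

lemma emb_conv_el: "emb p = el p 0" by (simp add: el_def)
lemma Y_conv_el: "Y = el 0 1" by (simp add: el_def)

lemma R_closed [simp, intro]:
  assumes "z \<in> R" "z' \<in> R"
  shows "z + z' \<in> R" "z - z' \<in> R" "- z \<in> R" "z * z' \<in> R"
  using assms by (auto elim!: R_cases simp: el_add el_diff el_uminus el_mult)

lemma R_basic [simp, intro]: "emb p \<in> R" "Y \<in> R" "0 \<in> R" "1 \<in> R"
  using el_in_R[of p 0] el_in_R[of 0 1] el_in_R[of 0 0] el_in_R[of 1 0] by (simp_all add: el_def)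

lemma R_power [simp, intro]: "z \<in> R \<Longrightarrow> z ^ n \<in> R"
  by (induction n) auto

definition coords :: "'k poly fract alg_closure \<Rightarrow> 'k poly \<times> 'k poly" where
  "coords z = (THE p. z = el (fst p) (snd p))"

lemma coords_el [simp]: "coords (el u v) = (u, v)"
  unfolding coords_def by (rule the_equality) auto

definition ev :: "'k \<Rightarrow> 'k \<Rightarrow> 'k poly fract alg_closure \<Rightarrow> 'k" where
  "ev x y z = poly (fst (coords z)) x + poly (snd (coords z)) x * y"

text \<open>The norm from the coordinate ring to k[x], the product of u + v Y with its conjugate u -
  v Y. Its degree gives 2 for x and 3 for y, their pole orders at O.\<close>

definition nrm :: "'k poly fract alg_closure \<Rightarrow> 'k poly" where
  "nrm z = fst (coords z) ^ 2 - snd (coords z) ^ 2 * cubic"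

definition on_curve :: "'k \<Rightarrow> 'k \<Rightarrow> bool" where
  "on_curve x y \<longleftrightarrow> y ^ 2 = x ^ 3 + a * x + b"

lemma on_curve_iff: "on_curve x y \<longleftrightarrow> Affine x y \<in> ec_points a b"
  by (auto simp: on_curve_def ec_points_def)

lemma on_curve_uminus [simp]: "on_curve x (- y) \<longleftrightarrow> on_curve x y"
  by (simp add: on_curve_def)

lemma ev_el: "ev x y (el u v) = poly u x + poly v x * y"
  by (simp add: ev_def)

lemma ev_basic [simp]: "ev x y (emb p) = poly p x" "ev x y Y = y" "ev x y 0 = 0" "ev x y 1 = 1"
  using ev_el[of x y p 0] ev_el[of x y 0 1] ev_el[of x y 0 0] ev_el[of x y 1 0]
  by (simp_all add: el_def)

lemma ev_add [simp]: "z \<in> R \<Longrightarrow> z' \<in> R \<Longrightarrow> ev x y (z + z') = ev x y z + ev x y z'"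
  and ev_diff [simp]: "z \<in> R \<Longrightarrow> z' \<in> R \<Longrightarrow> ev x y (z - z') = ev x y z - ev x y z'"
  and ev_uminus [simp]: "z \<in> R \<Longrightarrow> ev x y (- z) = - ev x y z"
  by (auto elim!: R_cases simp: el_add el_diff el_uminus ev_el algebra_simps)

lemma ev_mult [simp]:
  assumes "on_curve x y" "z \<in> R" "z' \<in> R"
  shows "ev x y (z * z') = ev x y z * ev x y z'"
proof -
  from assms obtain u v u' v' where z: "z = el u v" "z' = el u' v'" by (auto elim!: R_cases)
  have "poly cubic x = y * y"
    using assms(1) poly_cubic[of x] by (simp only: on_curve_def power2_eq_square)
  thus ?thesis by (simp only: z el_mult ev_el poly_add poly_mult) (simp add: algebra_simps)
qed

lemma ev_power [simp]: "on_curve x y \<Longrightarrow> z \<in> R \<Longrightarrow> ev x y (z ^ n) = ev x y z ^ n"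
  by (induction n) auto

lemma nrm_el: "nrm (el u v) = u ^ 2 - v ^ 2 * cubic"
  by (simp add: nrm_def)

lemma nrm_mult: "z \<in> R \<Longrightarrow> z' \<in> R \<Longrightarrow> nrm (z * z') = nrm z * nrm z'"
  by (auto elim!: R_cases simp: el_mult nrm_el power2_eq_square algebra_simps)

lemma nrm_eq_0_iff: "z \<in> R \<Longrightarrow> nrm z = 0 \<longleftrightarrow> z = 0"
  using odd_degree_cubic
  by (elim R_cases, cases "snd (coords z) = 0") (auto simp: nrm_el power2_eq_square)

lemma nrm_emb: "nrm (emb p) = p ^ 2"
  by (simp add: emb_conv_el nrm_el)

lemma degree_sq: "degree (u ^ 2) = 2 * degree (u::'k poly)"
  by (cases "u = 0") (simp_all add: degree_mult_eq power2_eq_square)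

lemma degree_sq_cubic: "degree (v ^ 2 * cubic) = (if v = 0 then 0 else 2 * degree v + 3)"
  for v :: "'k poly"
proof (cases "v = 0")
  case False
  hence "degree (v ^ 2 * cubic) = degree (v ^ 2) + degree cubic" by (intro degree_mult_eq) auto
  thus ?thesis using False by (simp add: degree_sq)
qed simp

text \<open>The leading terms of u^2 and v^2 times the cubic cannot cancel, one degree being even
  and the other odd. The case v = 0 is separate because \<open>degree 0 = 0\<close>.\<close>

lemma degree_nrm: "degree (nrm (el u v)) = max (2 * degree u) (if v = 0 then 0 else 2 * degree v + 3)"
proof -
  have ne: "v \<noteq> 0 \<Longrightarrow> 2 * degree u \<noteq> 2 * degree v + 3" by presburger
  have "degree (nrm (el u v)) = max (degree (u ^ 2)) (degree (v ^ 2 * cubic))"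
  proof (cases "v = 0")
    case False
    show ?thesis
    proof (cases "degree (u ^ 2) < degree (v ^ 2 * cubic)")
      case True
      thus ?thesis using degree_add_eq_right[of "u ^ 2" "- (v ^ 2 * cubic)"] by (simp add: nrm_el)
    next
      case False
      hence "degree (v ^ 2 * cubic) < degree (u ^ 2)"
        using ne \<open>v \<noteq> 0\<close> by (simp add: degree_sq degree_sq_cubic)
      thus ?thesis using degree_add_eq_left[of "- (v ^ 2 * cubic)" "u ^ 2"] by (simp add: nrm_el)
    qed
  qed (simp add: nrm_el)
  thus ?thesis unfolding degree_sq degree_sq_cubic .
qed

lemma degree_nrm_add:
  assumes "z \<in> R" "z' \<in> R"
  shows "degree (nrm (z + z')) \<le> max (degree (nrm z)) (degree (nrm z'))"
proof -
  from assms obtain u v u' v' where z: "z = el u v" "z' = el u' v'" by (auto elim!: R_cases)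
  show ?thesis
    unfolding z el_add degree_nrm
    using degree_add_le_max[of u u'] degree_add_le_max[of v v'] by auto
qed


section \<open>Ideals of points and the chord-tangent law\<close>

definition lin :: "'k \<Rightarrow> 'k poly" where "lin x = [:- x, 1:]"

abbreviation xf :: "'k \<Rightarrow> 'k poly fract alg_closure" where "xf x \<equiv> emb (lin x)"
abbreviation cf :: "'k \<Rightarrow> 'k poly fract alg_closure" where "cf c \<equiv> emb [:c:]"

lemma lin_nonzero [simp]: "lin x \<noteq> 0" and degree_lin [simp]: "degree (lin x) = 1"
  and poly_lin [simp]: "poly (lin x) z = z - x"
  by (simp_all add: lin_def)

lemma cf_simps: "cf (c + d) = cf c + cf d" "cf (c - d) = cf c - cf d" "cf (c * d) = cf c * cf d"
    "cf (- c) = - cf c" "cf 0 = 0" "cf 1 = 1" "cf c = 0 \<longleftrightarrow> c = 0"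
  by (simp_all flip: emb_simps(1-6) add: one_pCons mult.commute)

lemma cf_2: "cf 2 = 2"
  using cf_simps(1)[of 1 1] by (simp add: cf_simps one_add_one)

lemma xf_diff: "xf x - xf x' = cf (x' - x)"
  by (simp flip: emb_simps add: lin_def)

text \<open>Writing u + v Y = (u + y v) + v (Y - y), vanishing at (x, y) says that x is a root of u
  + y v. So the functions vanishing at the point are generated by x - x(P) and y - y(P).\<close>

lemma R_vanishing:
  assumes "z \<in> R" "ev x y z = 0"
  obtains p q where "p \<in> R" "q \<in> R" "z = xf x * p + (Y - cf y) * q"
proof -
  from assms obtain u v where z: "z = el u v" by (auto elim: R_cases)
  have "poly (u + [:y:] * v) x = 0" using assms z by (simp add: ev_el algebra_simps)
  then obtain p where "u + [:y:] * v = lin x * p"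
    unfolding poly_eq_0_iff_dvd lin_def by (elim dvdE)
  hence "emb u = xf x * emb p - cf y * emb v"
    by (metis (no_types) add_diff_cancel_right' emb_simps(3,6))
  hence "z = xf x * emb p + (Y - cf y) * emb v"
    by (simp add: z el_def algebra_simps)
  thus ?thesis using that by blast
qed

text \<open>The product of the maximal ideals of the listed points, in the coordinate ring.\<close>

fun pid :: "('k \<times> 'k) list \<Rightarrow> 'k poly fract alg_closure set" where
  "pid [] = R"
| "pid ((x, y) # L) = {xf x * g + (Y - cf y) * h | g h. g \<in> pid L \<and> h \<in> pid L}"

lemma pid_sub_R: "z \<in> pid L \<Longrightarrow> z \<in> R"
  by (induction L arbitrary: z rule: pid.induct) auto

lemma pid_add: "z \<in> pid L \<Longrightarrow> z' \<in> pid L \<Longrightarrow> z + z' \<in> pid L"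
proof (induction L arbitrary: z z' rule: pid.induct)
  case (2 x y L)
  then obtain g h g' h' where *: "z = xf x * g + (Y - cf y) * h" "z' = xf x * g' + (Y - cf y) * h'"
    "g \<in> pid L" "h \<in> pid L" "g' \<in> pid L" "h' \<in> pid L" by auto
  hence "z + z' = xf x * (g + g') + (Y - cf y) * (h + h')" by (simp add: ring_distribs)
  thus ?case using * 2 by auto
qed auto

lemma pid_mult: "z \<in> pid L \<Longrightarrow> r \<in> R \<Longrightarrow> r * z \<in> pid L"
proof (induction L arbitrary: z rule: pid.induct)
  case (2 x y L)
  then obtain g h where *: "z = xf x * g + (Y - cf y) * h" "g \<in> pid L" "h \<in> pid L" by auto
  hence "r * z = xf x * (r * g) + (Y - cf y) * (r * h)" by (simp only: ring_distribs mult_ac)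
  thus ?case using * 2 by auto
qed auto

lemma pid_uminus: "z \<in> pid L \<Longrightarrow> - z \<in> pid L"
  using pid_mult[of z L "- emb 1"] R_closed(3)[OF R_basic(1)[of 1], OF R_basic(1)[of 1]] by simp

lemma pid_diff: "z \<in> pid L \<Longrightarrow> z' \<in> pid L \<Longrightarrow> z - z' \<in> pid L"
  using pid_add[OF _ pid_uminus] by force

text \<open>Nonzero constants are units. Several membership proofs below first reach a constant
  multiple such as 2y or x2 - x1 times the desired element.\<close>

lemma pid_cancel:
  assumes "cf c * z \<in> pid L" "c \<noteq> 0"
  shows "z \<in> pid L"
proof -
  have "cf (inverse c) * cf c = cf (inverse c * c)" by (simp only: cf_simps)
  also have "\<dots> = 1" using assms by (simp add: cf_simps)
  finally have "cf (inverse c) * (cf c * z) = z" by (simp only: mult.assoc[symmetric] mult_1)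
  thus ?thesis using pid_mult[OF assms(1) R_basic(1), of "[:inverse c:]"] by (simp only:)
qed

lemma pid_ConsI:
  assumes "f \<in> R" "ev x y f = 0" "g \<in> pid L"
  shows "f * g \<in> pid ((x, y) # L)"
proof -
  obtain p q where "p \<in> R" "q \<in> R" "f = xf x * p + (Y - cf y) * q" using assms R_vanishing by blast
  hence eq: "f * g = xf x * (p * g) + (Y - cf y) * (q * g)" by (simp only: ring_distribs mult_ac)
  have "p * g \<in> pid L" "q * g \<in> pid L"
    using \<open>p \<in> R\<close> \<open>q \<in> R\<close> assms(3) pid_mult by auto
  thus ?thesis unfolding eq pid.simps by blast
qed

text \<open>The second generator may be replaced by any line through the point.\<close>

lemma pid_ConsE:
  assumes "z \<in> pid ((x, y) # L)" "Y - cf y = l + c * xf x" "c \<in> R"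
  obtains g h where "g \<in> pid L" "h \<in> pid L" "z = xf x * g + l * h"
proof -
  obtain g h where *: "g \<in> pid L" "h \<in> pid L" "z = xf x * g + (Y - cf y) * h" using assms by auto
  hence "z = xf x * (g + c * h) + l * h" unfolding assms(2) by (simp add: algebra_simps)
  moreover have "g + c * h \<in> pid L" using * assms by (simp add: pid_add pid_mult)
  ultimately show ?thesis using * that by blast
qed

lemma ev_pid:
  assumes "z \<in> pid L" "(x, y) \<in> set L" "\<forall>(x, y) \<in> set L. on_curve x y"
  shows "ev x y z = 0"
  using assms
proof (induction L arbitrary: z rule: pid.induct)
  case (2 x' y' L)
  then obtain g h where *: "z = xf x' * g + (Y - cf y') * h" "g \<in> pid L" "h \<in> pid L" by auto
  have [simp]: "g \<in> R" "h \<in> R" using * pid_sub_R by auto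
  have [simp]: "on_curve x y" using 2 by auto
  have "ev x y g = 0 \<and> ev x y h = 0" if "(x, y) \<in> set L" using 2 * that by auto
  moreover have "(x, y) = (x', y') \<or> (x, y) \<in> set L" using 2 by auto
  ultimately show ?case using * by auto
qed auto

text \<open>Maximal ideals of distinct points are comaximal, so their product is their intersection.\<close>

lemma pid_distinctI:
  assumes "distinct L" "\<forall>(x, y) \<in> set L. on_curve x y"
    "z \<in> R" "\<And>x y. (x, y) \<in> set L \<Longrightarrow> ev x y z = 0"
  shows "z \<in> pid L"
  using assms
proof (induction L)
  case (Cons P L)
  obtain x y where P: "P = (x, y)" by fastforce
  have oc: "on_curve x y" using Cons P by auto
  have z: "z \<in> pid L" using Cons by auto
  \<comment> \<open>Each point of the list differs from (x, y) in a coordinate, and the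
    corresponding generator of its ideal does not vanish at (x, y); g is the product of these
    generators.\<close>
  have "\<exists>g \<in> pid L'. ev x y g \<noteq> 0" if "set L' \<subseteq> set L" for L'
    using that
  proof (induction L')
    case (Cons Q L')
    obtain x' y' where Q: "Q = (x', y')" by fastforce
    from Cons obtain g where g: "g \<in> pid L'" "ev x y g \<noteq> 0" by auto
    hence gR: "g \<in> R" using pid_sub_R by auto
    have "(x', y') \<noteq> (x, y)" using Cons Q P \<open>distinct (P # L)\<close> by auto
    hence "x \<noteq> x' \<or> y \<noteq> y'" by auto
    thus ?case
    proof
      assume "x \<noteq> x'"
      moreover have "xf x' * g \<in> pid ((x', y') # L')" using g by (intro pid_ConsI) auto
      ultimately show ?thesis using Q g gR oc by (intro bexI[of _ "xf x' * g"]) auto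
    next
      assume "y \<noteq> y'"
      moreover have "(Y - cf y') * g \<in> pid ((x', y') # L')" using g by (intro pid_ConsI) auto
      ultimately show ?thesis using Q g gR oc by (intro bexI[of _ "(Y - cf y') * g"]) auto
    qed
  qed (auto intro!: bexI[of _ 1])
  from this[of L] obtain g where g: "g \<in> pid L" "ev x y g \<noteq> 0" by auto
  hence gR: "g \<in> R" using pid_sub_R by auto
  \<comment> \<open>Comaximality made explicit: e lies in \<open>pid L\<close> and 1 - e vanishes at
    (x, y). In z = z e + (1 - e) z both summands lie in the product ideal, one because z vanishes at
    the point, the other because z is in \<open>pid L\<close>.\<close>
  define e where "e = cf (inverse (ev x y g)) * g"
  have e: "e \<in> pid L" "e \<in> R" "ev x y e = 1" using g gR oc by (auto simp: e_def pid_mult)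
  have "z * e \<in> pid ((x, y) # L)" using e Cons P by (intro pid_ConsI) auto
  moreover have "(1 - e) * z \<in> pid ((x, y) # L)" using e z by (intro pid_ConsI) auto
  ultimately have "z * e + (1 - e) * z \<in> pid ((x, y) # L)" by (rule pid_add)
  moreover have "z * e + (1 - e) * z = z" by (simp add: algebra_simps)
  ultimately show ?case using P by simp
qed auto

lemma Y_sq_minus:
  assumes "on_curve x y"
  obtains s where "(Y - cf y) * (Y + cf y) = xf x * emb s" "y = 0 \<Longrightarrow> poly s x \<noteq> 0"
proof -
  have oc: "y * y = x * x * x + a * x + b"
    using assms by (simp add: on_curve_def power2_eq_square power3_eq_cube mult.assoc)
  \<comment> \<open>The quotient of cubic(X) - cubic(x) by X - x, whose value at x is the derivative
    3 x^2 + a.\<close>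
  define s where "s = [:x * x + a, x, 1:]"
  have "cubic - [:y:] * [:y:] = lin x * s"
    using oc by (simp add: cubic_def lin_def s_def algebra_simps)
  hence "emb (cubic - [:y:] * [:y:]) = xf x * emb s" by simp
  moreover have "(Y - cf y) * (Y + cf y) = emb (cubic - [:y:] * [:y:])"
    by (simp add: algebra_simps Y_mult_Y del: mult_pCons_left mult_pCons_right)
  \<comment> \<open>If y and the derivative both vanished, x would be a double root of the cubic,
    forcing a = -3 x^2 and b = 2 x^3 and thus discriminant zero.\<close>
  moreover have "poly s x \<noteq> 0" if "y = 0"
  proof
    assume "poly s x = 0"
    hence "a + x * (x * 3) = 0" by (simp add: s_def algebra_simps)
    hence a: "a = - (3 * x * x)" by (simp add: eq_neg_iff_add_eq_0 mult.commute)
    have "b = - (x * x * x + a * x)" using oc that eq_neg_iff_add_eq_0[of b "x * x * x + a * x"] by (simp add: add_ac)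
    hence b: "b = 2 * x * x * x" unfolding a by (simp add: algebra_simps)
    have "4 * a ^ 3 + 27 * b ^ 2 = 0" unfolding b unfolding a
      by (simp add: power2_eq_square power3_eq_cube)
    thus False using nonsingular by (simp add: ec_nonsingular_def)
  qed
  ultimately show ?thesis using that by metis
qed

text \<open>The vertical line through P cuts the curve in P and -P. Each product of a generator at P
  and one at -P is divisible by \<open>xf x\<close>; for (Y - y)(Y + y) this is the curve
  equation.\<close>

lemma vertical_down:
  assumes "on_curve x y" "z \<in> pid ((x, y) # (x, - y) # L)"
  obtains g where "g \<in> pid L" "z = xf x * g"
proof -
  obtain s where s: "(Y - cf y) * (Y + cf y) = xf x * emb s" using Y_sq_minus[OF assms(1)] by metis
  obtain g h where 1: "g \<in> pid ((x, - y) # L)" "h \<in> pid ((x, - y) # L)" "z = xf x * g + (Y - cf y) * h"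
    using assms(2) by auto
  obtain g1 h1 where h: "g1 \<in> pid L" "h1 \<in> pid L" "h = xf x * g1 + (Y + cf y) * h1"
    using 1(2) by (auto simp: cf_simps)
  obtain g2 h2 where g: "g2 \<in> pid L" "h2 \<in> pid L" "g = xf x * g2 + (Y + cf y) * h2"
    using 1(1) by (auto simp: cf_simps)
  have "z = xf x * g + ((Y - cf y) * xf x * g1 + ((Y - cf y) * (Y + cf y)) * h1)"
    unfolding 1 h by (simp only: algebra_simps)
  also have "\<dots> = xf x * (g + (Y - cf y) * g1 + emb s * h1)"
    unfolding s by (simp add: algebra_simps)
  finally show ?thesis
    using that g h by (metis pid_add pid_mult R_basic(1,2) R_closed(1,2))
qed

text \<open>For y \<noteq> 0 the generators Y + y and Y - y differ by the unit 2y. For y = 0 the two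
  points coincide, and Y^2 = (X - x) s with s(x) \<noteq> 0 by nonsingularity yields X - x up to a
  multiple of its square.\<close>

lemma vertical_up:
  assumes "on_curve x y" "g \<in> pid L"
  shows "xf x * g \<in> pid ((x, y) # (x, - y) # L)"
proof (cases "y = 0")
  case False
  have 1: "xf x * ((Y + cf y) * g) \<in> pid ((x, y) # (x, - y) # L)"
    using assms by (intro pid_ConsI) auto
  have 2: "(Y - cf y) * (xf x * g) \<in> pid ((x, y) # (x, - y) # L)"
    using assms by (intro pid_ConsI) auto
  have "xf x * ((Y + cf y) * g) - (Y - cf y) * (xf x * g) = cf (2 * y) * (xf x * g)"
    by (simp only: cf_simps cf_2) (simp add: algebra_simps)
  with pid_diff[OF 1 2] have "cf (2 * y) * (xf x * g) \<in> pid ((x, y) # (x, - y) # L)" by simp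
  from pid_cancel[OF this] show ?thesis using False two by simp
next
  case True
  obtain s where s: "(Y - cf y) * (Y + cf y) = xf x * emb s" "poly s x \<noteq> 0"
    using Y_sq_minus[OF assms(1)] True by metis
  have "lin x dvd s - [:poly s x:]"
    unfolding lin_def poly_eq_0_iff_dvd[symmetric] by simp
  then obtain r where "s - [:poly s x:] = lin x * r" by (elim dvdE)
  hence "emb (s - [:poly s x:]) = xf x * emb r" by simp
  hence r: "cf (poly s x) = emb s - xf x * emb r" by (simp add: algebra_simps)
  have 1: "(Y - cf y) * ((Y + cf y) * g) \<in> pid ((x, y) # (x, - y) # L)"
    using assms by (intro pid_ConsI) auto
  have 2: "xf x * (xf x * (emb r * g)) \<in> pid ((x, y) # (x, - y) # L)"
    using assms by (intro pid_ConsI pid_mult) auto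
  have "(Y - cf y) * ((Y + cf y) * g) - xf x * (xf x * (emb r * g)) = cf (poly s x) * (xf x * g)"
    unfolding r mult.assoc[symmetric] s by (simp add: algebra_simps)
  with pid_diff[OF 1 2] have "cf (poly s x) * (xf x * g) \<in> pid ((x, y) # (x, - y) # L)" by simp
  from pid_cancel[OF this] show ?thesis using s by simp
qed

text \<open>Chord and tangent in one format: the slope m enters later only through the line equation
  and the factorization of the polynomial of intersection abscissas.\<close>

lemma chord_exists:
  assumes "on_curve x1 y1" "on_curve x2 y2" "\<not> (x1 = x2 \<and> y1 = - y2)"
  obtains m x3 y3 where "ec_add a (Affine x1 y1) (Affine x2 y2) = Affine x3 y3"
    "on_curve x3 y3" "y3 = m * (x1 - x3) - y1" "y2 = y1 + m * (x2 - x1)"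
    "cubic - [:y1 - m * x1, m:] ^ 2 = lin x1 * lin x2 * lin x3"
    "x1 = x2 \<Longrightarrow> y1 = y2 \<and> y1 \<noteq> 0"
proof -
  have o1: "y1 ^ 2 = x1 ^ 3 + a * x1 + b" and o2: "y2 ^ 2 = x2 ^ 3 + a * x2 + b"
    using assms by (auto simp: on_curve_def)
  have same: "y1 = y2 \<and> y1 \<noteq> 0" if "x1 = x2"
  proof -
    have "y1 ^ 2 = y2 ^ 2" using o1 o2 that by simp
    hence "y1 = y2" using assms(3) that by (auto simp: power2_eq_iff)
    thus ?thesis using assms(3) that by auto
  qed
  define m where "m = (if x1 = x2 then (3 * x1 ^ 2 + a) / (2 * y1) else (y2 - y1) / (x2 - x1))"
  define x3 where "x3 = m ^ 2 - x1 - x2"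
  define y3 where "y3 = m * (x1 - x3) - y1"
  have add: "ec_add a (Affine x1 y1) (Affine x2 y2) = Affine x3 y3"
    using assms(3) by (simp add: Let_def m_def x3_def y3_def)
  have y2: "y2 = y1 + m * (x2 - x1)" using same by (auto simp: m_def)
  \<comment> \<open>For distinct abscissas this is the difference of the two curve equations divided
    by x2 - x1; for a tangent it is the definition of the slope.\<close>
  have E: "2 * y1 * m + m ^ 2 * (x2 - x1) = x1 ^ 2 + x1 * x2 + x2 ^ 2 + a"
  proof (cases "x1 = x2")
    case True
    have "2 * y1 \<noteq> 0" using conjunct2[OF same[OF True]] two by simp
    hence "m * (2 * y1) = 3 * x1 ^ 2 + a" using True by (simp add: m_def)
    thus ?thesis using True by (simp add: power2_eq_square algebra_simps)
  next
    case False
    have "0 = y2 ^ 2 - y1 ^ 2 - (x2 ^ 3 - x1 ^ 3 + a * (x2 - x1))"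
      unfolding o1 o2 by (simp add: algebra_simps)
    also have "\<dots> = (x2 - x1) *
        (2 * y1 * m + m ^ 2 * (x2 - x1) - (x1 ^ 2 + x1 * x2 + x2 ^ 2 + a))"
      unfolding y2 by (simp add: power2_eq_square power3_eq_cube algebra_simps)
    finally show ?thesis using False by simp
  qed
  \<comment> \<open>With a and b eliminated, comparing coefficients of the factorization becomes a
    matter of polynomial identities in x1, x2, y1 and m.\<close>
  hence a_eq: "a = 2 * y1 * m + m ^ 2 * (x2 - x1) - (x1 ^ 2 + x1 * x2 + x2 ^ 2)"
    by (simp add: algebra_simps)
  have b_eq: "b = y1 ^ 2 - x1 ^ 3 - a * x1" using o1 by (simp add: algebra_simps)
  have c1: "a - 2 * m * (y1 - m * x1) = x1 * x2 + x1 * x3 + x2 * x3"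
    unfolding a_eq x3_def by (simp add: power2_eq_square algebra_simps)
  have c0: "b - (y1 - m * x1) ^ 2 = - (x1 * x2 * x3)"
    unfolding b_eq unfolding a_eq x3_def
    by (simp add: power2_eq_square power3_eq_cube algebra_simps)
  have "cubic - [:y1 - m * x1, m:] ^ 2
      = [:b - (y1 - m * x1) ^ 2, a - 2 * m * (y1 - m * x1), - (m ^ 2), 1:]"
    by (simp add: cubic_def power2_eq_square algebra_simps)
  also have "\<dots> = [:- (x1 * x2 * x3), x1 * x2 + x1 * x3 + x2 * x3, - (x1 + x2 + x3), 1:]"
    unfolding c0 c1 by (simp add: x3_def)
  also have "\<dots> = lin x1 * lin x2 * lin x3"
    by (simp add: lin_def algebra_simps)
  finally have poly: "cubic - [:y1 - m * x1, m:] ^ 2 = lin x1 * lin x2 * lin x3" .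
  have "poly (cubic - [:y1 - m * x1, m:] ^ 2) x3 = 0" unfolding poly by simp
  hence "on_curve x3 y3" by (simp add: poly_cubic on_curve_def y3_def power2_eq_square algebra_simps)
  from that[OF add this y3_def y2 poly same] show ?thesis .
qed


section \<open>The line through two points as a function on the curve\<close>

context
  fixes x1 y1 x2 y2 x3 y3 m :: 'k
  assumes oc1: "on_curve x1 y1" and oc2: "on_curve x2 y2"
    and y3: "y3 = m * (x1 - x3) - y1" and y2: "y2 = y1 + m * (x2 - x1)"
    and chord: "cubic - [:y1 - m * x1, m:] ^ 2 = lin x1 * lin x2 * lin x3"
    and tangent: "x1 = x2 \<Longrightarrow> y1 \<noteq> 0"
begin

private abbreviation "l \<equiv> Y - emb [:y1 - m * x1, m:]"
private abbreviation "l' \<equiv> Y + emb [:y1 - m * x1, m:]"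

text \<open>\<open>l'\<close> is the conjugate of the line \<open>l\<close> up to sign. Since (x3,
  y3) is the sum of the two points, \<open>l\<close> meets the curve again in (x3, - y3), and
  \<open>l'\<close> is the one that vanishes at (x3, y3).\<close>

lemma chord_norm: "l * l' = xf x1 * xf x2 * xf x3"
proof -
  have "l * l' = emb (cubic - [:y1 - m * x1, m:] ^ 2)"
    by (simp add: Y_mult_Y power2_eq_square algebra_simps del: mult_pCons_left mult_pCons_right)
  thus ?thesis unfolding chord by simp
qed

lemma chord_in_R: "l \<in> R" "l' \<in> R" by auto

lemma chord_at: "Y - cf y1 = l + cf m * xf x1" "Y - cf y2 = l + cf m * xf x2"
    "Y - cf y3 = l' + cf (- m) * xf x3"
proof -
  have line: "emb [:y1 - m * x1, m:] = cf y + cf m * xf x" if "y = y1 + m * (x - x1)" for x y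
  proof -
    have "[:y1 - m * x1, m:] = [:y:] + [:m:] * lin x" by (simp add: that lin_def algebra_simps)
    thus ?thesis by (simp only: emb_simps)
  qed
  show "Y - cf y1 = l + cf m * xf x1" by (subst line[of y1 x1]) simp_all
  show "Y - cf y2 = l + cf m * xf x2" by (subst line[of y2 x2]) (simp_all add: y2)
  show "Y - cf y3 = l' + cf (- m) * xf x3"
    by (subst line[of "- y3" x3]) (simp_all add: y3 cf_simps algebra_simps)
qed

lemma ev_chord: "ev x1 y1 l = 0" "ev x2 y2 l = 0" "ev x3 y3 l' = 0"
  by (simp_all add: y2 y3 algebra_simps)

text \<open>With P3 = P1 + P2, the divisor of \<open>l\<close> is P1 + P2 + (-P3) - 3O and that of
  \<open>xf x3\<close> is P3 + (-P3) - 2O. Multiplying by their quotient \<open>xf x3 / l\<close>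
  trades the zeros P1 and P2 for a zero at P3.\<close>

lemma chord_down:
  assumes "z \<in> pid ((x1, y1) # (x2, y2) # L)"
  obtains g where "g \<in> pid ((x3, y3) # L)" "z * xf x3 = l * g"
proof -
  obtain g h where 1: "g \<in> pid ((x2, y2) # L)" "h \<in> pid ((x2, y2) # L)" "z = xf x1 * g + l * h"
    using pid_ConsE[OF assms chord_at(1) R_basic(1)] by blast
  obtain g1 h1 where g: "g1 \<in> pid L" "h1 \<in> pid L" "g = xf x2 * g1 + l * h1"
    using pid_ConsE[OF 1(1) chord_at(2) R_basic(1)] by blast
  obtain g2 h2 where h: "g2 \<in> pid L" "h2 \<in> pid L" "h = xf x2 * g2 + l * h2"
    using pid_ConsE[OF 1(2) chord_at(2) R_basic(1)] by blast
  let ?r = "xf x1 * h1 + xf x2 * g2 + l * h2"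
  have "z * xf x3 = (xf x1 * xf x2 * xf x3) * g1 + l * (xf x3 * ?r)"
    unfolding 1 g h by (simp only: algebra_simps)
  also have "\<dots> = l * (l' * g1 + xf x3 * ?r)"
    unfolding chord_norm[symmetric] by (simp only: algebra_simps)
  finally have eq: "z * xf x3 = l * (l' * g1 + xf x3 * ?r)" .
  have "?r \<in> pid L" using g h by (intro pid_add pid_mult) auto
  hence "xf x3 * ?r \<in> pid ((x3, y3) # L)" by (intro pid_ConsI) auto
  moreover have "l' * g1 \<in> pid ((x3, y3) # L)"
    using g ev_chord chord_in_R by (intro pid_ConsI)
  ultimately show ?thesis using that[OF _ eq] pid_add by blast
qed

text \<open>For distinct abscissas the generators \<open>xf x1\<close> and \<open>xf x2\<close>
  differ by a unit, so \<open>l\<close> is obtained from multiples of both. For a tangent,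
  \<open>l\<close> has to be extracted from second-order terms, which costs the factor 2 y1.\<close>

lemma chord_mult_pid:
  assumes "g \<in> pid L"
  shows "l * g \<in> pid ((x1, y1) # (x2, y2) # L)"
proof (cases "x1 = x2")
  case False
  have "xf x1 * (l * g) \<in> pid ((x1, y1) # (x2, y2) # L)"
    using assms ev_chord chord_in_R by (intro pid_ConsI) auto
  moreover have "l * (xf x2 * g) \<in> pid ((x1, y1) # (x2, y2) # L)"
    using assms ev_chord chord_in_R by (intro pid_ConsI) auto
  ultimately have "xf x1 * (l * g) - l * (xf x2 * g) \<in> pid ((x1, y1) # (x2, y2) # L)"
    by (rule pid_diff)
  moreover have "xf x1 * (l * g) - l * (xf x2 * g) = (xf x1 - xf x2) * (l * g)"
    by (simp only: algebra_simps)
  ultimately have "cf (x2 - x1) * (l * g) \<in> pid ((x1, y1) # (x2, y2) # L)"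
    unfolding xf_diff by (simp only:)
  thus ?thesis by (rule pid_cancel) (use False in simp)
next
  case True
  have eq: "(x2, y2) = (x1, y1)" using y2 True by simp
  let ?I = "pid ((x1, y1) # (x2, y2) # L)"
  have 1: "xf x1 * (xf x1 * (xf x3 * g)) \<in> ?I" "l * (l * g) \<in> ?I"
      "xf x1 * (l * (cf (2 * m) * g)) \<in> ?I"
    unfolding eq
    by ((intro pid_ConsI pid_mult; (rule chord_in_R ev_chord assms R_basic | simp))+)
  \<comment> \<open>\<open>l' - l\<close> is twice the line polynomial, expanded at x1. Inserting
    this into \<open>chord_norm\<close> and solving for 2 y1 \<open>l\<close> leaves only products
    of two elements vanishing at the point.\<close>
  have "l' = l + (cf (2 * m) * xf x1 + cf (2 * y1))"
    unfolding diff_conv_add_uminus add.assoc add_left_cancel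
    by (simp flip: emb_simps add: lin_def algebra_simps)
  hence "l * l' = l * (l + (cf (2 * m) * xf x1 + cf (2 * y1)))" by (simp only:)
  also have "\<dots> = l * l + (cf (2 * m) * xf x1 + cf (2 * y1)) * l"
    by (simp only: distrib_left mult.commute)
  finally have "l * l' = l * l + (cf (2 * m) * xf x1 + cf (2 * y1)) * l" .
  hence "l * l + (cf (2 * m) * xf x1 + cf (2 * y1)) * l = xf x1 * xf x1 * xf x3"
    unfolding chord_norm using True by simp
  hence "cf (2 * y1) * l = xf x1 * xf x1 * xf x3 - l * l - cf (2 * m) * xf x1 * l"
    by (simp only: algebra_simps)
  hence "(cf (2 * y1) * l) * g = (xf x1 * xf x1 * xf x3 - l * l - cf (2 * m) * xf x1 * l) * g"
    by (simp only:)
  hence "cf (2 * y1) * (l * g) = xf x1 * (xf x1 * (xf x3 * g)) - l * (l * g) - xf x1 * (l * (cf (2 * m) * g))"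
    by (simp only: algebra_simps)
  also have "\<dots> \<in> ?I" using 1 by (intro pid_diff)
  finally show ?thesis by (rule pid_cancel) (use tangent True two in simp)
qed

text \<open>The inverse trade: for g = (X - x3) g1 + l' h1 the product l g is divisible by X - x3,
  because l l' is.\<close>

lemma chord_up:
  assumes "g \<in> pid ((x3, y3) # L)"
  obtains z where "z \<in> pid ((x1, y1) # (x2, y2) # L)" "z * xf x3 = l * g"
proof -
  obtain g1 h1 where g: "g1 \<in> pid L" "h1 \<in> pid L" "g = xf x3 * g1 + l' * h1"
    using pid_ConsE[OF assms chord_at(3) R_basic(1)] by blast
  have "l * g1 \<in> pid ((x1, y1) # (x2, y2) # L)" using chord_mult_pid g by simp
  moreover have "xf x1 * (xf x2 * h1) \<in> pid ((x1, y1) # (x2, y2) # L)"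
    using g by (intro pid_ConsI) auto
  ultimately have "l * g1 + xf x1 * (xf x2 * h1) \<in> pid ((x1, y1) # (x2, y2) # L)"
    by (rule pid_add)
  moreover have "l * g = l * (xf x3 * g1) + (l * l') * h1" unfolding g by (simp only: algebra_simps)
  hence "(l * g1 + xf x1 * (xf x2 * h1)) * xf x3 = l * g"
    unfolding chord_norm by (simp only: algebra_simps)
  ultimately show ?thesis using that by blast
qed

lemma degree_nrm_chord: "degree (nrm l) = 3" "l \<noteq> 0"
proof -
  have l: "l = el (- [:y1 - m * x1, m:]) 1"
    by (simp only: el_def emb_simps mult_1 diff_conv_add_uminus add.commute)
  show "l \<noteq> 0" unfolding l by simp
  have "degree [:y1 - m * x1, m:] \<le> 1" by simp
  hence "2 * degree [:y1 - m * x1, m:] \<le> 3" by linarith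
  thus "degree (nrm l) = 3" unfolding l degree_nrm degree_minus by (simp add: max_def)
qed

text \<open>The line has pole order 3 at O and \<open>xf x3\<close> has pole order 2, so the degree
  drops by one, just as the list of zeros does.\<close>

lemma degree_chord_quotient:
  assumes "z * xf x3 = l * g" "z \<in> R" "g \<in> R" "z \<noteq> 0 \<or> g \<noteq> 0"
  shows "z \<noteq> 0" "g \<noteq> 0" "degree (nrm g) + 1 = degree (nrm z)"
proof -
  show nz: "z \<noteq> 0" "g \<noteq> 0" using assms degree_nrm_chord(2) by (auto simp del: emb_simps(3,4))
  have "nrm z * nrm (xf x3) = nrm l * nrm g"
    using arg_cong[OF assms(1), of nrm] assms(2,3) chord_in_R by (simp only: nrm_mult R_basic)
  hence "degree (nrm z * nrm (xf x3)) = degree (nrm l * nrm g)" by (simp only:)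
  moreover have "nrm z \<noteq> 0" "nrm g \<noteq> 0" "nrm l \<noteq> 0"
    using nz degree_nrm_chord(2) assms(2,3) chord_in_R by (simp_all only: nrm_eq_0_iff not_False_eq_True)
  ultimately have "degree (nrm z) + 2 = 3 + degree (nrm g)"
    by (simp add: degree_mult_eq nrm_emb degree_sq degree_nrm_chord)
  thus "degree (nrm g) + 1 = degree (nrm z)" by simp
qed

end

text \<open>The recursion performs exactly the reductions of the two inductions below. Dropping an
  intermediate \<open>Infinity\<close> keeps the list affine, as \<open>pid\<close> requires; the
  comparison with the group sum comes in \<open>psum_conv_finprod\<close>.\<close>

fun psum :: "('k \<times> 'k) list \<Rightarrow> 'k ec_point" where
  "psum [] = Infinity"
| "psum [(x, y)] = Affine x y"
| "psum ((x1, y1) # (x2, y2) # L) =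
     (case ec_add a (Affine x1 y1) (Affine x2 y2) of
        Infinity \<Rightarrow> psum L | Affine x y \<Rightarrow> psum ((x, y) # L))"

lemma degree_nrm_vertical:
  assumes "g \<in> R" "g \<noteq> 0"
  shows "degree (nrm (xf x * g)) = degree (nrm g) + 2"
  using assms by (simp add: nrm_mult nrm_emb degree_mult_eq degree_sq nrm_eq_0_iff)

text \<open>The possible degrees are even or at least 3: no function has a simple pole at O as its
  only pole. This is the reason a single affine point cannot have sum O.\<close>

lemma degree_nrm_not_1:
  assumes "z \<in> R" shows "degree (nrm z) \<noteq> 1"
proof -
  obtain u v where "z = el u v" using assms by (auto elim: R_cases)
  moreover have "2 * degree u \<noteq> 1" by presburger
  ultimately show ?thesis by (simp add: degree_nrm max_def)
qed

lemma degree_nrm_0: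
  assumes "z \<in> R" "degree (nrm z) = 0" obtains c where "z = cf c"
proof -
  obtain u v where z: "z = el u v" using assms by (auto elim: R_cases)
  hence "degree u = 0" "v = 0" using assms(2) by (auto simp: degree_nrm split: if_splits)
  thus ?thesis using that z by (auto simp: el_def elim!: degree_eq_zeroE)
qed

lemma ec_add_cases:
  assumes "on_curve x1 y1" "on_curve x2 y2"
  obtains "ec_add a (Affine x1 y1) (Affine x2 y2) = Infinity" "x2 = x1" "y2 = - y1"
  | m x3 y3 where "ec_add a (Affine x1 y1) (Affine x2 y2) = Affine x3 y3"
    "on_curve x3 y3" "y3 = m * (x1 - x3) - y1" "y2 = y1 + m * (x2 - x1)"
    "cubic - [:y1 - m * x1, m:] ^ 2 = lin x1 * lin x2 * lin x3" "x1 = x2 \<Longrightarrow> y1 \<noteq> 0"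
proof (cases "x1 = x2 \<and> y1 = - y2")
  case True
  show ?thesis by (rule that(1)) (use True in auto)
next
  case False
  show ?thesis by (rule chord_exists[OF assms False]) (rule that(2), assumption+, blast)
qed

text \<open>A reduction lowers length and degree equally, by two for opposite points and by one
  otherwise, so their difference is invariant. It remains to treat the empty list and a single
  point, where degrees 0 and 1 are impossible and the inequality is strict.\<close>

lemma pid_degree:
  assumes "z \<in> pid L" "z \<noteq> 0" "\<forall>(x, y) \<in> set L. on_curve x y"
  shows "length L \<le> degree (nrm z) \<and> (length L = degree (nrm z) \<longrightarrow> psum L = Infinity)"
  using assms
proof (induction L arbitrary: z rule: psum.induct)
  case (2 x y)
  have zR: "z \<in> R" using 2 pid_sub_R by blast
  have "degree (nrm z) \<noteq> 0"
  proof
    assume "degree (nrm z) = 0"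
    then obtain c where z: "z = cf c" using degree_nrm_0 zR by blast
    have "ev x y z = 0" using ev_pid[of z "[(x, y)]"] 2 by auto
    thus False using 2 z by simp
  qed
  thus ?case using degree_nrm_not_1[OF zR] by auto
next
  case (3 x1 y1 x2 y2 L)
  have zR: "z \<in> R" using 3 pid_sub_R by blast
  have oc: "on_curve x1 y1" "on_curve x2 y2" using 3 by auto
  from oc show ?case
  proof (cases rule: ec_add_cases)
    case 1
    obtain g where g: "g \<in> pid L" "z = xf x1 * g"
      using vertical_down[of x1 y1 z L] 3 1 oc by metis
    have "length L \<le> degree (nrm g) \<and> (length L = degree (nrm g) \<longrightarrow> psum L = Infinity)"
      using 3 1 g by auto
    moreover have "degree (nrm z) = degree (nrm g) + 2"
      using g 3 pid_sub_R by (auto simp: degree_nrm_vertical)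
    ultimately show ?thesis using 1 by (auto simp del: ec_add.simps)
  next
    case (2 m x3 y3)
    note c = 2(3-6)
    obtain g where g: "g \<in> pid ((x3, y3) # L)" "z * xf x3 = (Y - emb [:y1 - m * x1, m:]) * g"
      using chord_down[OF oc c] 3 by metis
    have "degree (nrm g) + 1 = degree (nrm z)" "g \<noteq> 0"
      using degree_chord_quotient[OF oc c g(2) zR] g pid_sub_R 3 by auto
    moreover have "length ((x3, y3) # L) \<le> degree (nrm g) \<and>
        (length ((x3, y3) # L) = degree (nrm g) \<longrightarrow> psum ((x3, y3) # L) = Infinity)"
      by (rule 3(2)) (use 2 g \<open>g \<noteq> 0\<close> 3(5) in auto)
    ultimately show ?thesis using 2 by (auto simp del: ec_add.simps)
  qed
qed auto

text \<open>The same reductions run backwards, starting from the constant 1 for the empty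
  list.\<close>

lemma pid_exists:
  assumes "psum L = Infinity" "\<forall>(x, y) \<in> set L. on_curve x y"
  obtains z where "z \<in> pid L" "z \<noteq> 0" "degree (nrm z) = length L"
proof -
  have "\<exists>z \<in> pid L. z \<noteq> 0 \<and> degree (nrm z) = length L"
    using assms
  proof (induction L rule: psum.induct)
    case 1
    have "nrm 1 = 1" using nrm_emb[of 1] by simp
    thus ?case by (intro bexI[of _ 1]) auto
  next
    case (3 x1 y1 x2 y2 L)
    have oc: "on_curve x1 y1" "on_curve x2 y2" using 3 by auto
    from oc show ?case
    proof (cases rule: ec_add_cases)
      case 1
      hence "psum L = Infinity" using 3(3) by (simp del: ec_add.simps)
      then obtain g where g: "g \<in> pid L" "g \<noteq> 0" "degree (nrm g) = length L"
        using 3 1 by auto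
      show ?thesis
        using vertical_up[OF oc(1) g(1)] g degree_nrm_vertical[of g x1] pid_sub_R 1
        by (intro bexI[of _ "xf x1 * g"]) auto
    next
      case (2 m x3 y3)
      note c = 2(3-6)
      have "psum ((x3, y3) # L) = Infinity" using 3(3) 2 by (simp del: ec_add.simps)
      hence "\<exists>g \<in> pid ((x3, y3) # L). g \<noteq> 0 \<and> degree (nrm g) = length ((x3, y3) # L)"
        by (intro 3(2)) (use 2 3(4) in auto)
      then obtain g where g: "g \<in> pid ((x3, y3) # L)" "g \<noteq> 0" "degree (nrm g) = length ((x3, y3) # L)"
        by blast
      obtain z where z: "z \<in> pid ((x1, y1) # (x2, y2) # L)" "z * xf x3 = (Y - emb [:y1 - m * x1, m:]) * g"
        using chord_up[OF oc c g(1)] by metis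
      have "degree (nrm g) + 1 = degree (nrm z)" "z \<noteq> 0"
        using degree_chord_quotient[OF oc c z(2)] z(1) g pid_sub_R by blast+
      thus ?thesis using g z by (intro bexI[of _ z]) auto
    qed
  qed auto
  thus ?thesis using that by blast
qed

end

section \<open>Valuations of the function field\<close>

lemma power_int_eq_cases:
  fixes z :: "'a::field"
  assumes "z \<noteq> 0" "A = z powi n * B"
  shows "(0 \<le> n \<and> A = z ^ nat n * B) \<or> (n < 0 \<and> A * z ^ nat (- n) = B)"
proof (cases "0 \<le> n")
  case False
  hence "z powi n * z ^ nat (- n) = z powi n * z powi (- n)" by (simp add: power_int_def)
  also have "\<dots> = 1" using assms(1) by (simp flip: power_int_add)
  finally show ?thesis using False assms(2) by (simp add: mult_ac)
qed (use assms in \<open>simp add: power_int_def\<close>)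

context weierstrass begin

abbreviation "K \<equiv> ec_function_field a b"

lemma K_simps [simp]:
  "carrier K = UNIV" "\<zero>\<^bsub>K\<^esub> = (0, 0)" "ffun (f \<otimes>\<^bsub>K\<^esub> g) = ffun f * ffun g"
  "ffun (f \<oplus>\<^bsub>K\<^esub> g) = ffun f + ffun g"
  by (auto simp: ec_function_field_def ffun_mult ffun_add split_beta cubic_def)

lemma ffun_zero [simp]: "ffun (0, 0) = 0" by (simp add: ffun_eq_0_iff)

lemma ffun_minus_K [simp]: "ffun (f \<ominus>\<^bsub>K\<^esub> g) = ffun f - ffun g"
proof -
  have "\<ominus>\<^bsub>K\<^esub> g = (- fst g, - snd g)"
    unfolding a_inv_def m_inv_def
    by (rule the_equality) (auto simp: ec_function_field_def split_beta prod_eq_iff eq_neg_iff_add_eq_0 add.commute)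
  thus ?thesis by (simp add: a_minus_def flip: ffun_uminus)
qed

lemma ffun_const [simp]: "ffun (ec_const c) = cf c"
  and ffun_x: "ffun ec_x = xf 0"
  and ffun_y [simp]: "ffun ec_y = Y"
  by (simp_all add: ffun_def ec_const_def ec_x_def ec_y_def emb_def lin_def)

lemma ffun_x_minus [simp]: "ffun ec_x - cf c = xf c"
  unfolding ffun_x by (simp flip: emb_simps add: lin_def)

definition FF :: "'k poly fract alg_closure set" where "FF = range ffun"

lemma FF_cases: assumes "z \<in> FF" obtains f where "z = ffun f"
  using assms by (auto simp: FF_def)

lemma R_sub_FF: "z \<in> R \<Longrightarrow> z \<in> FF"
  by (auto elim!: R_cases simp: el_conv_ffun FF_def)

lemma FF_closed: assumes "z \<in> FF" "z' \<in> FF" shows "z * z' \<in> FF" "z + z' \<in> FF" "z - z' \<in> FF"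
  using assms by (auto elim!: FF_cases simp: FF_def ffun_mult ffun_add ffun_diff)

lemma FF_denominator:
  assumes "f \<in> FF"
  obtains q z where "q \<noteq> 0" "z \<in> R" "f * emb q = z"
proof -
  obtain u v where f: "f = ffun (u, v)" using assms by (auto elim: FF_cases)
  obtain p q where u: "u = to_fract p / to_fract q" "q \<noteq> 0"
    by (cases u) (auto simp: Fract_conv_to_fract)
  obtain p' q' where v: "v = to_fract p' / to_fract q'" "q' \<noteq> 0"
    by (cases v) (auto simp: Fract_conv_to_fract)
  have "f * emb (q * q') = el (p * q') (p' * q)"
    using u(2) v(2) by (simp add: f ffun_def el_def emb_def u v field_simps)
  thus ?thesis using that[of "q * q'"] u v by auto
qed

text \<open>Transports a valuation from pairs of rational functions to their images in the ambient
  field; it is meaningful on \<open>FF\<close> only.\<close>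

definition val :: "('k ec_fun \<Rightarrow> int) \<Rightarrow> 'k poly fract alg_closure \<Rightarrow> int" where
  "val v z = v (inv_into UNIV ffun z)"

lemma val_ffun [simp]: "val v (ffun f) = v f"
  by (simp add: val_def inj_ffun)

lemma ec_valuation_iff:
  "ec_valuation a b v \<longleftrightarrow> v \<in> extensional (UNIV - {(0, 0)}) \<and>
     (\<forall>z\<in>FF - {0}. \<forall>z'\<in>FF - {0}. val v (z * z') = val v z + val v z') \<and>
     (\<forall>z\<in>FF - {0}. \<forall>z'\<in>FF - {0}. z + z' \<noteq> 0 \<longrightarrow> min (val v z) (val v z') \<le> val v (z + z')) \<and>
     (\<forall>c. c \<noteq> 0 \<longrightarrow> val v (cf c) = 0) \<and> (\<exists>z\<in>FF - {0}. val v z = 1)"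
proof -
  have FF0: "FF - {0} = ffun ` (UNIV - {(0, 0)})"
    by (auto simp: FF_def ffun_eq_0_iff)
  have mult: "v (f \<otimes>\<^bsub>K\<^esub> g) = val v (ffun f * ffun g)" for f g by (simp flip: K_simps(3))
  have add: "v (f \<oplus>\<^bsub>K\<^esub> g) = val v (ffun f + ffun g)" for f g by (simp flip: K_simps(4))
  have zero: "f \<oplus>\<^bsub>K\<^esub> g \<noteq> (0, 0) \<longleftrightarrow> ffun f + ffun g \<noteq> 0" for f g
    by (simp flip: K_simps(4) add: ffun_eq_0_iff)
  have const: "v (ec_const c) = val v (cf c)" for c by (simp flip: ffun_const)
  show ?thesis
    unfolding ec_valuation_def Let_def K_simps FF0 mult add zero const ball_simps bex_simps val_ffun ..
qed

text \<open>Discharges the definite description in \<open>ec_ord\<close>. H is a candidate order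
  given as a relation, since it will be read off from a non-unique representation. The assumptions
  up to \<open>param\<close> make it a normalized valuation, \<open>centred\<close> places it at P,
  and \<open>determined\<close> yields uniqueness.\<close>

lemma ec_ord_eqI:
  fixes H :: "'k poly fract alg_closure \<Rightarrow> int \<Rightarrow> bool"
  assumes total: "\<And>z. z \<in> FF \<Longrightarrow> z \<noteq> 0 \<Longrightarrow> \<exists>n. H z n"
    and unique: "\<And>z n m. z \<noteq> 0 \<Longrightarrow> H z n \<Longrightarrow> H z m \<Longrightarrow> n = m"
    and mult: "\<And>z z' n m. z \<noteq> 0 \<Longrightarrow> z' \<noteq> 0 \<Longrightarrow> H z n \<Longrightarrow> H z' m \<Longrightarrow> H (z * z') (n + m)"
    and add: "\<And>z z' n m. z \<noteq> 0 \<Longrightarrow> z' \<noteq> 0 \<Longrightarrow> H z n \<Longrightarrow> H z' m \<Longrightarrow> z + z' \<noteq> 0 \<Longrightarrow>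
               \<exists>l \<ge> min n m. H (z + z') l"
    and const: "\<And>c. c \<noteq> 0 \<Longrightarrow> H (cf c) 0"
    and param: "\<exists>z \<in> FF - {0}. H z 1"
    and centred: "\<And>v. (\<And>f n. f \<noteq> (0, 0) \<Longrightarrow> H (ffun f) n \<Longrightarrow> v f = n) \<Longrightarrow> ec_centred_at a b v P"
    and determined: "\<And>v z n. ec_valuation a b v \<Longrightarrow> ec_centred_at a b v P \<Longrightarrow> z \<in> FF \<Longrightarrow> z \<noteq> 0 \<Longrightarrow>
               H z n \<Longrightarrow> val v z = n"
    and f: "f \<noteq> (0, 0)"
  shows "H (ffun f) (ec_ord a b P f)"
proof -
  \<comment> \<open>The value \<open>undefined\<close> at zero matches the extensionality in
    \<open>ec_valuation\<close>, so that uniqueness holds as an equality of functions.\<close>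
  define v where "v = (\<lambda>f. if f = (0, 0) then undefined else THE n. H (ffun f) n)"
  have v: "H (ffun f) n \<Longrightarrow> v f = n" if "f \<noteq> (0, 0)" for f n
    unfolding v_def using that unique[of "ffun f"] by (auto intro!: the_equality simp: ffun_eq_0_iff)
  have val: "H z n \<Longrightarrow> val v z = n" if "z \<in> FF" "z \<noteq> 0" for z n
    using that v by (auto elim!: FF_cases simp: ffun_eq_0_iff)
  have valuation: "ec_valuation a b v"
    unfolding ec_valuation_iff
  proof (intro conjI ballI impI allI)
    show "v \<in> extensional (UNIV - {(0, 0)})" by (auto simp: extensional_def v_def)
    fix z z' assume z: "z \<in> FF - {0}" "z' \<in> FF - {0}"
    then obtain n m where nm: "H z n" "H z' m" using total[of z] total[of z'] by blast
    show "val v (z * z') = val v z + val v z'"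
      using z nm val mult FF_closed(1) by auto
    assume "z + z' \<noteq> 0"
    then obtain l where "l \<ge> min n m" "H (z + z') l" using add[OF _ _ nm] z by auto
    thus "min (val v z) (val v z') \<le> val v (z + z')"
      using z nm val FF_closed(2) \<open>z + z' \<noteq> 0\<close> by auto
  next
    fix c :: 'k assume "c \<noteq> 0"
    thus "val v (cf c) = 0" using val[of "cf c" 0] const R_sub_FF by simp
  next
    show "\<exists>z\<in>FF - {0}. val v z = 1" using param val by auto
  qed
  have centre: "ec_centred_at a b v P" using centred v by blast
  have "ec_ord a b P = v"
    unfolding ec_ord_def
  proof (rule the_equality)
    fix v' assume v': "ec_valuation a b v' \<and> ec_centred_at a b v' P"
    have "v' g = v g" for g
    proof (cases "g = (0, 0)")
      case True
      thus ?thesis using v' valuation by (auto simp: ec_valuation_iff extensional_def)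
    next
      case False
      then obtain n where "H (ffun g) n" using total[of "ffun g"] by (auto simp: FF_def ffun_eq_0_iff)
      thus ?thesis using v[of g] False determined[of v' "ffun g"] v' by (auto simp: FF_def ffun_eq_0_iff)
    qed
    thus "v' = v" by auto
  qed (use valuation centre in auto)
  thus ?thesis using f total[of "ffun f"] v[of f] by (auto simp: FF_def ffun_eq_0_iff)
qed

context
  fixes v assumes v: "ec_valuation a b v"
begin

lemma val_mult: "z \<in> FF \<Longrightarrow> z \<noteq> 0 \<Longrightarrow> z' \<in> FF \<Longrightarrow> z' \<noteq> 0 \<Longrightarrow> val v (z * z') = val v z + val v z'"
  and val_const: "c \<noteq> 0 \<Longrightarrow> val v (cf c) = 0"
  using v by (auto simp: ec_valuation_iff)

lemma val_uminus: assumes "z \<in> FF" "z \<noteq> 0" shows "val v (- z) = val v z"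
  using val_mult[of "cf (- 1)" z] val_const[of "- 1"] assms
    R_sub_FF[OF R_closed(3)[OF R_basic(4) R_basic(4)]] by (simp add: cf_simps)

lemma val_add_ge:
  assumes "z \<in> FF" "z' \<in> FF" "z = 0 \<or> n \<le> val v z" "z' = 0 \<or> n \<le> val v z'" "z + z' \<noteq> 0"
  shows "n \<le> val v (z + z')"
proof (cases "z = 0 \<or> z' = 0")
  case False
  hence "min (val v z) (val v z') \<le> val v (z + z')" using v assms by (auto simp: ec_valuation_iff)
  thus ?thesis using assms False by auto
qed (use assms in auto)

lemma val_add_eq:
  assumes "z \<in> FF" "z' \<in> FF" "z \<noteq> 0" "z' = 0 \<or> val v z < val v z'"
  shows "z + z' \<noteq> 0" "val v (z + z') = val v z"
proof -
  show nz: "z + z' \<noteq> 0"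
  proof
    assume "z + z' = 0"
    hence "z' = - z" by (simp add: add_eq_0_iff)
    thus False using assms val_uminus by auto
  qed
  have "val v z \<le> val v (z + z')" using assms nz by (intro val_add_ge) auto
  moreover have "\<not> val v z + 1 \<le> val v (z + z')"
  proof
    assume *: "val v z + 1 \<le> val v (z + z')"
    have m: "- z' \<in> FF" using FF_closed(3)[OF R_sub_FF[OF R_basic(3)] assms(2)] by simp
    have z': "- z' = 0 \<or> val v z + 1 \<le> val v (- z')"
      using assms(2,4) val_uminus[of z'] by (cases "z' = 0") auto
    have "val v z + 1 \<le> val v ((z + z') + - z')"
      by (intro val_add_ge FF_closed m z') (use assms * in auto)
    thus False by simp
  qed
  ultimately show "val v (z + z') = val v z" by simp
qed

lemma val_power: assumes "z \<in> FF" "z \<noteq> 0" shows "val v (z ^ n) = int n * val v z" "z ^ n \<in> FF"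
proof -
  have "val v (z ^ n) = int n * val v z \<and> z ^ n \<in> FF"
  proof (induction n)
    case 0
    show ?case using val_const[of 1] R_sub_FF[of 1] by (simp add: cf_simps)
  qed (use assms val_mult in \<open>auto simp: algebra_simps FF_closed\<close>)
  thus "val v (z ^ n) = int n * val v z" "z ^ n \<in> FF" by auto
qed

end


text \<open>Horner's scheme around x: polynomials are reached from constants and the single function
  \<open>xf x\<close>, the only ones whose valuations are known at the start.\<close>

lemma emb_induct: "P (emb p)" if "\<And>c. P (cf c)" "\<And>q c. P (emb q) \<Longrightarrow> P (cf c + xf x * emb q)"
proof -
  have "\<forall>p. degree p \<le> n \<longrightarrow> P (emb p)" for n
  proof (induction n)
    case 0
    show ?case using that(1) by (auto elim!: degree_eq_zeroE)
  next
    case (Suc n)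
    show ?case
    proof (intro allI impI)
      fix p :: "'k poly" assume *: "degree p \<le> Suc n"
      have "degree (synthetic_div p x) \<le> n" using * by (simp add: degree_synthetic_div)
      hence "P (cf (poly p x) + xf x * emb (synthetic_div p x))" using Suc that(2) by blast
      moreover have "cf (poly p x) + xf x * emb (synthetic_div p x) = emb p"
        using synthetic_div_correct'[of x p] by (simp flip: emb_simps add: lin_def add.commute)
      ultimately show "P (emb p)" by simp
    qed
  qed
  thus ?thesis by blast
qed

lemma Y_nonzero [simp]: "Y \<noteq> 0"
  by (simp add: Y_conv_el)

section \<open>The order at an affine point\<close>

context
  fixes x0 y0 :: 'k
  assumes oc: "on_curve x0 y0"
begin

private abbreviation "e \<equiv> ev x0 y0"

text \<open>A local parameter. Where y0 = 0 the tangent is vertical, x - x0 vanishes to order 2, and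
  y takes its place.\<close>

definition unif :: "'k poly fract alg_closure" where
  "unif = (if y0 = 0 then Y else xf x0)"

lemma unif [simp]: "unif \<in> R" "unif \<in> FF" "unif \<noteq> 0" "e unif = 0"
  using R_sub_FF by (auto simp: unif_def)

text \<open>States f = unif^n g / h with g and h units of the local ring, written without forming
  that ring.\<close>

definition has_ord :: "'k poly fract alg_closure \<Rightarrow> int \<Rightarrow> bool" where
  "has_ord f n \<longleftrightarrow> (\<exists>g\<in>R. \<exists>h\<in>R. e g \<noteq> 0 \<and> e h \<noteq> 0 \<and> f * h = unif powi n * g)"

lemma e_mult [simp]: "z \<in> R \<Longrightarrow> z' \<in> R \<Longrightarrow> e (z * z') = e z * e z'"
  and e_power [simp]: "z \<in> R \<Longrightarrow> e (z ^ n) = e z ^ n"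
  using oc by auto

lemma has_ordI: "g \<in> R \<Longrightarrow> h \<in> R \<Longrightarrow> e g \<noteq> 0 \<Longrightarrow> e h \<noteq> 0 \<Longrightarrow> f * h = unif powi n * g \<Longrightarrow> has_ord f n"
  unfolding has_ord_def by blast

lemma has_ordE:
  assumes "has_ord f n"
  obtains g h where "g \<in> R" "h \<in> R" "e g \<noteq> 0" "e h \<noteq> 0" "f * h = unif powi n * g" "g \<noteq> 0" "h \<noteq> 0"
  using assms unfolding has_ord_def by force

lemma unif_powi_nonneg: "0 \<le> n \<Longrightarrow> unif powi n = unif ^ nat n"
  by (simp add: power_int_def)

text \<open>Evaluation at the point decides both claims: \<open>unif\<close> vanishes there while g
  and h do not, so a negative exponent moved to the other side would make g vanish.\<close>

lemma has_ord_R: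
  assumes "has_ord z n" "z \<in> R"
  shows "0 \<le> n" "n = 0 \<longleftrightarrow> e z \<noteq> 0"
proof -
  obtain g h where 1: "g \<in> R" "h \<in> R" "e g \<noteq> 0" "e h \<noteq> 0" "z * h = unif powi n * g"
    using assms(1) by (rule has_ordE)
  show n: "0 \<le> n"
  proof (rule ccontr)
    assume "\<not> 0 \<le> n"
    hence "(z * h) * unif ^ nat (- n) = g" "nat (- n) \<noteq> 0" using power_int_eq_cases[OF unif(3) 1(5)] by auto
    moreover have "e ((z * h) * unif ^ k) = e z * e h * 0 ^ k" for k
      using 1(2) assms(2) by simp
    ultimately have "e z * e h * 0 ^ nat (- n) = e g" by metis
    thus False using 1(3) \<open>nat (- n) \<noteq> 0\<close> by (simp add: power_0_left)
  qed
  hence "e (z * h) = e (unif ^ nat n * g)" using 1(5) by (simp add: unif_powi_nonneg)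
  moreover have "e (z * h) = e z * e h" "e (unif ^ nat n * g) = e unif ^ nat n * e g"
    using 1(1,2) assms(2) by (simp_all del: unif(4))
  ultimately have "e z * e h = e unif ^ nat n * e g" by simp
  thus "n = 0 \<longleftrightarrow> e z \<noteq> 0" using 1(3,4) n by (auto simp: power_0_left split: if_splits)
qed

lemma has_ord_mult:
  assumes "has_ord z n" "has_ord z' m" shows "has_ord (z * z') (n + m)"
proof -
  obtain g h where 1: "g \<in> R" "h \<in> R" "e g \<noteq> 0" "e h \<noteq> 0" "z * h = unif powi n * g"
    using assms(1) by (rule has_ordE)
  obtain g' h' where 2: "g' \<in> R" "h' \<in> R" "e g' \<noteq> 0" "e h' \<noteq> 0" "z' * h' = unif powi m * g'"
    using assms(2) by (rule has_ordE)
  have "(z * z') * (h * h') = (z * h) * (z' * h')" by (simp only: mult_ac)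
  also have "\<dots> = unif powi (n + m) * (g * g')"
    unfolding 1 2 by (simp add: power_int_add mult_ac)
  finally show ?thesis using 1 2 by (intro has_ordI[of "g * g'" "h * h'"]) auto
qed

lemma has_ord_divide:
  assumes "has_ord (z * z') n" "has_ord z' m" "z' \<noteq> 0" shows "has_ord z (n - m)"
proof -
  obtain g h where 1: "g \<in> R" "h \<in> R" "e g \<noteq> 0" "e h \<noteq> 0" "z * z' * h = unif powi n * g"
    using assms(1) by (rule has_ordE)
  obtain g' h' where 2: "g' \<in> R" "h' \<in> R" "e g' \<noteq> 0" "e h' \<noteq> 0" "z' * h' = unif powi m * g'"
    using assms(2) by (rule has_ordE)
  have "unif powi m * (z * (g' * h)) = z * (z' * h') * h" unfolding 2 by (simp only: mult_ac)
  also have "\<dots> = (z * z' * h) * h'" by (simp only: mult_ac)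
  also have "\<dots> = unif powi m * (unif powi (n - m) * (g * h'))"
    unfolding 1 by (simp add: mult.assoc flip: power_int_add mult.assoc[of "unif powi m"])
  finally have "z * (g' * h) = unif powi (n - m) * (g * h')" by simp
  thus ?thesis using 1 2 by (intro has_ordI[of "g * h'" "g' * h"]) auto
qed

lemma has_ord_unit: "z \<in> R \<Longrightarrow> e z \<noteq> 0 \<Longrightarrow> has_ord z 0"
  by (rule has_ordI[of z 1]) auto

lemma has_ord_unif: "has_ord unif 1"
  by (rule has_ordI[of 1 1]) auto

lemma has_ord_unique:
  assumes "has_ord z n" "has_ord z m" "z \<noteq> 0" shows "n = m"
proof -
  have "has_ord 1 (n - m)" using has_ord_divide[of 1 z n m] assms by simp
  thus ?thesis using has_ord_R[of 1] by force
qed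

lemma has_ord_power: "has_ord z n \<Longrightarrow> has_ord (z ^ k) (int k * n)"
proof (induction k)
  case (Suc k)
  thus ?case using has_ord_mult[of z n "z ^ k" "int k * n"] by (simp add: algebra_simps)
qed (simp add: has_ord_unit)

lemma has_ord_xf: "has_ord (xf x0) (if y0 = 0 then 2 else 1)"
proof (cases "y0 = 0")
  case True
  obtain s where s: "(Y - cf y0) * (Y + cf y0) = xf x0 * emb s" "poly s x0 \<noteq> 0"
    using Y_sq_minus[OF oc] True by metis
  have "unif = Y" unfolding unif_def using True by simp
  moreover have "xf x0 * emb s = Y * Y" using s True by (simp add: cf_simps)
  ultimately have "xf x0 * emb s = unif powi 2 * 1" by (simp only: power_int_numeral power2_eq_square mult_1_right)
  hence "has_ord (xf x0) 2" using s(2) by (intro has_ordI[of 1 "emb s"]) auto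
  thus ?thesis using True by simp
next
  case False
  thus ?thesis using has_ord_unif by (simp add: unif_def)
qed

lemma has_ord_emb:
  assumes "p \<noteq> 0" shows "has_ord (emb p) ((if y0 = 0 then 2 else 1) * int (order x0 p))"
proof -
  obtain q where q: "p = lin x0 ^ order x0 p * q" "\<not> lin x0 dvd q"
    using order_decomp[OF assms] by (auto simp: lin_def)
  hence "poly q x0 \<noteq> 0" by (simp add: poly_eq_0_iff_dvd lin_def)
  hence "has_ord (emb q) 0" by (intro has_ord_unit) auto
  hence "has_ord (xf x0 ^ order x0 p * emb q) (int (order x0 p) * (if y0 = 0 then 2 else 1) + 0)"
    by (intro has_ord_mult has_ord_power has_ord_xf)
  moreover have "emb p = xf x0 ^ order x0 p * emb q" using arg_cong[OF q(1), of emb] by simp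
  ultimately show ?thesis by (simp add: mult.commute)
qed

lemma has_ord_add_less:
  assumes "has_ord z n" "has_ord z' m" "n < m" shows "has_ord (z + z') n"
proof -
  obtain g h where 1: "g \<in> R" "h \<in> R" "e g \<noteq> 0" "e h \<noteq> 0" "z * h = unif powi n * g"
    using assms(1) by (rule has_ordE)
  obtain g' h' where 2: "g' \<in> R" "h' \<in> R" "e g' \<noteq> 0" "e h' \<noteq> 0" "z' * h' = unif powi m * g'"
    using assms(2) by (rule has_ordE)
  have "unif powi m = unif powi n * unif powi (m - n)" by (simp flip: power_int_add)
  also have "unif powi (m - n) = unif ^ nat (m - n)" using assms(3) by (simp add: unif_powi_nonneg)
  finally have m: "unif powi m = unif powi n * unif ^ nat (m - n)" .
  have "(z + z') * (h * h') = (z * h) * h' + (z' * h') * h" by (simp only: algebra_simps)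
  also have "\<dots> = unif powi n * (g * h' + unif ^ nat (m - n) * (g' * h))"
    unfolding 1 2 m by (simp only: algebra_simps)
  finally show ?thesis using 1 2 assms(3)
    by (intro has_ordI[of "g * h' + unif ^ nat (m - n) * (g' * h)" "h * h'"]) (auto simp: zero_power)
qed

text \<open>For y0 = 0 the summands u and v Y have orders of different parity, so the smaller one
  wins. For y0 \<noteq> 0, if the conjugate of z does not vanish at the point, z inherits the order
  of its norm, a polynomial; if both vanish, so do u and v at x0, and dividing by x - x0 lowers the
  degree of the norm.\<close>

lemma has_ord_exists_R:
  assumes "z \<in> R" "z \<noteq> 0" shows "\<exists>n. has_ord z n"
proof (cases "y0 = 0")
  case True
  obtain u v where z: "z = emb u + emb v * Y" using assms by (auto elim: R_cases simp: el_def)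
  have "unif = Y" unfolding unif_def using True by simp
  hence Y: "has_ord Y 1" using has_ord_unif by metis
  show ?thesis
  proof (cases "u = 0 \<or> v = 0")
    case True
    thus ?thesis using has_ord_emb[of u] has_ord_mult[OF has_ord_emb[of v] Y] z assms by auto
  next
    case False
    have 1: "has_ord (emb u) (2 * int (order x0 u))" "has_ord (emb v * Y) (2 * int (order x0 v) + 1)"
      using has_ord_emb[of u] has_ord_mult[OF has_ord_emb[of v] Y] False True by auto
    have "2 * int (order x0 u) \<noteq> 2 * int (order x0 v) + 1" by presburger
    thus ?thesis using has_ord_add_less[OF 1] has_ord_add_less[OF 1(2,1)] z
      by (metis add.commute linorder_neqE)
  qed
next
  case y0: False
  show ?thesis
    using assms
  proof (induction "degree (nrm z)" arbitrary: z rule: less_induct)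
    case less
    obtain u v where z: "z = el u v" using less by (auto elim: R_cases)
    show ?case
    proof (cases "e z = 0")
      case False
      thus ?thesis using has_ord_unit less by blast
    next
      case ez: True
      let ?z = "el u (- v)"
      show ?thesis
      proof (cases "e ?z = 0")
        case False
        have "nrm z = u * u - v * v * cubic" unfolding z nrm_el by (simp add: power2_eq_square)
        hence "z * ?z = emb (nrm z)" unfolding z el_mult by (simp add: emb_conv_el mult.commute)
        moreover have "nrm z \<noteq> 0" using less nrm_eq_0_iff by simp
        ultimately obtain n where n: "has_ord (z * ?z) n" using has_ord_emb by metis
        have "?z \<noteq> 0" using False by (metis ev_basic(3))
        from has_ord_divide[OF n has_ord_unit[OF el_in_R False] this] show ?thesis by blast
      next
        case True
        have "(poly u x0 + poly v x0 * y0) + (poly u x0 - poly v x0 * y0) = 0"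
          using ez True unfolding z by (simp add: ev_el)
        hence "2 * poly u x0 = 0" by simp
        hence u0: "poly u x0 = 0" using two by simp
        hence v0: "poly v x0 = 0" using ez y0 unfolding z by (simp add: ev_el)
        obtain u' v' where uv: "u = lin x0 * u'" "v = lin x0 * v'"
          using u0 v0 unfolding poly_eq_0_iff_dvd lin_def by (auto elim!: dvdE)
        have z': "z = xf x0 * el u' v'" unfolding z uv by (simp add: el_def algebra_simps)
        hence "el u' v' \<noteq> 0" using less by auto
        hence "degree (nrm (el u' v')) < degree (nrm z)" unfolding z' by (subst degree_nrm_vertical) auto
        then obtain n where "has_ord (el u' v') n" using less \<open>el u' v' \<noteq> 0\<close> by blast
        thus ?thesis unfolding z' using has_ord_mult has_ord_xf by blast
      qed
    qed
  qed
qed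

lemma has_ord_exists:
  assumes "z \<in> FF" "z \<noteq> 0" shows "\<exists>n. has_ord z n"
proof -
  obtain q z' where q: "q \<noteq> 0" "z' \<in> R" "z * emb q = z'" using assms FF_denominator by metis
  hence "z' \<noteq> 0" using assms by auto
  then obtain n where "has_ord (z * emb q) n" using has_ord_exists_R q by blast
  from has_ord_divide[OF this has_ord_emb[OF q(1)]] show ?thesis using q(1) by auto
qed

lemma has_ord_add:
  assumes "has_ord z n" "has_ord z' m" "n \<le> m" "z + z' \<noteq> 0"
  shows "\<exists>l\<ge>n. has_ord (z + z') l"
proof -
  obtain g h where 1: "g \<in> R" "h \<in> R" "e g \<noteq> 0" "e h \<noteq> 0" "z * h = unif powi n * g" "h \<noteq> 0"
    using assms(1) by (rule has_ordE)
  obtain g' h' where 2: "g' \<in> R" "h' \<in> R" "e g' \<noteq> 0" "e h' \<noteq> 0" "z' * h' = unif powi m * g'" "h' \<noteq> 0"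
    using assms(2) by (rule has_ordE)
  have "unif powi m = unif powi n * unif powi (m - n)" by (simp flip: power_int_add)
  also have "unif powi (m - n) = unif ^ nat (m - n)" using assms(3) by (simp add: unif_powi_nonneg)
  finally have m: "unif powi m = unif powi n * unif ^ nat (m - n)" .
  define B where "B = g * h' + unif ^ nat (m - n) * (g' * h)"
  have BR: "B \<in> R" using 1(1,2) 2(1,2) by (auto simp: B_def)
  have "(z + z') * (h * h') = (z * h) * h' + (z' * h') * h" by (simp only: algebra_simps)
  also have "\<dots> = unif powi n * B"
    unfolding 1 2 m B_def by (simp only: algebra_simps)
  finally have eq: "(z + z') * (h * h') = unif powi n * B" .
  hence "B \<noteq> 0" using assms(4) 1(6) 2(6) by auto
  then obtain l where l: "has_ord B l" using has_ord_exists_R BR by blast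
  have "has_ord (unif powi n) n" by (rule has_ordI[of 1 1]) auto
  hence A: "has_ord ((z + z') * (h * h')) (n + l)" unfolding eq using l by (rule has_ord_mult)
  have B: "has_ord (h * h') 0" using 1(2,4) 2(2,4) by (intro has_ord_unit) auto
  have "has_ord (z + z') (n + l - 0)" by (rule has_ord_divide[OF A B]) (use 1(6) 2(6) in simp)
  thus ?thesis using has_ord_R(1)[OF l BR] by (intro exI[of _ "n + l"]) auto
qed

text \<open>The centre makes \<open>v\<close> nonnegative on the coordinate ring and positive on the
  ideal of the point, hence zero on elements that do not vanish there. So \<open>v\<close> is
  \<open>has_ord\<close> scaled by \<open>val v unif\<close>.\<close>

lemma val_affine:
  assumes v: "ec_valuation a b v" and c: "ec_centred_at a b v (Affine x0 y0)"
    and z: "z \<in> FF" "z \<noteq> 0" "has_ord z n"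
  shows "val v z = n"
proof -
  note mult = val_mult[OF v] and add = val_add_ge[OF v] and const = val_const[OF v]
  have lift: "f = \<zero>\<^bsub>K\<^esub> \<or> 0 < v f \<longleftrightarrow> ffun f = 0 \<or> 0 < val v (ffun f)" for f
    by (simp add: ffun_eq_0_iff)
  have X0: "0 < val v (xf x0)" and Y0: "Y - cf y0 = 0 \<or> 0 < val v (Y - cf y0)"
    using c unfolding ec_centred_at.simps Let_def lift by auto
  have xy: "xf x0 \<in> FF" "Y - cf y0 \<in> FF" "cf y0 \<in> FF" using R_sub_FF by auto
  have R_nonneg: "z = 0 \<or> 0 \<le> val v z" if zR: "z \<in> R" for z
  proof -
    have p: "emb p = 0 \<or> 0 \<le> val v (emb p)" for p
    proof (rule emb_induct[of "\<lambda>z. z = 0 \<or> 0 \<le> val v z" x0])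
      show "cf c = 0 \<or> 0 \<le> val v (cf c)" for c using const[of c] by (cases "c = 0") auto
      fix q c assume q: "emb q = 0 \<or> 0 \<le> val v (emb q)"
      have "xf x0 * emb q = 0 \<or> 0 \<le> val v (xf x0 * emb q)"
        using q mult[of "xf x0" "emb q"] X0 R_sub_FF by (cases "q = 0") auto
      moreover have "cf c = 0 \<or> 0 \<le> val v (cf c)" using const[of c] by (cases "c = 0") auto
      ultimately show "cf c + xf x0 * emb q = 0 \<or> 0 \<le> val v (cf c + xf x0 * emb q)"
        using add[of "cf c" "xf x0 * emb q" 0] R_sub_FF by blast
    qed
    have cy: "cf y0 = 0 \<or> 0 \<le> val v (cf y0)" using p by blast
    have "Y - cf y0 + cf y0 = 0 \<or> 0 \<le> val v (Y - cf y0 + cf y0)"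
      using add[OF xy(2,3) _ cy] Y0 by force
    hence Y: "0 \<le> val v Y" by (simp add: Y_conv_el)
    obtain p q where z: "z = emb p + emb q * Y" using zR by (auto elim: R_cases simp: el_def)
    have "emb q * Y = 0 \<or> 0 \<le> val v (emb q * Y)"
      using p[of q] Y mult[of "emb q" Y] R_sub_FF by (cases "q = 0") (auto simp: Y_conv_el)
    thus ?thesis unfolding z using add[OF _ _ p] R_sub_FF by blast
  qed
  have M_pos: "z = 0 \<or> 0 < val v z" if zR: "z \<in> R" "e z = 0" for z
  proof -
    obtain p q where pq: "p \<in> R" "q \<in> R" "z = xf x0 * p + (Y - cf y0) * q"
      using R_vanishing[OF zR] by blast
    have "xf x0 * p = 0 \<or> 1 \<le> val v (xf x0 * p)"
      using mult[of "xf x0" p] R_nonneg[OF pq(1)] X0 R_sub_FF pq(1) by (cases "p = 0") auto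
    moreover have "(Y - cf y0) * q = 0 \<or> 1 \<le> val v ((Y - cf y0) * q)"
      using mult[of "Y - cf y0" q] R_nonneg[OF pq(2)] Y0 R_sub_FF[OF pq(2)] xy(2) by fastforce
    ultimately have "z = 0 \<or> 1 \<le> val v z"
      unfolding pq using add[of "xf x0 * p" "(Y - cf y0) * q" 1] xy R_sub_FF pq FF_closed(1) by blast
    thus ?thesis by auto
  qed
  have U_zero: "val v z = 0" if "z \<in> R" "e z \<noteq> 0" for z
  proof -
    have FFz: "cf (e z) \<in> FF" "z - cf (e z) \<in> FF" using R_sub_FF that by auto
    have "z - cf (e z) = 0 \<or> 0 < val v (z - cf (e z))" using that by (intro M_pos) auto
    hence "val v (cf (e z) + (z - cf (e z))) = val v (cf (e z))"
      using that const by (intro val_add_eq[OF v]) (use FFz in auto)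
    thus ?thesis using const[OF that(2)] by simp
  qed
  have ord: "val v z = n * val v unif" if zn: "z \<in> FF" "z \<noteq> 0" "has_ord z n" for z n
  proof -
    obtain g h where 1: "g \<in> R" "h \<in> R" "e g \<noteq> 0" "e h \<noteq> 0" "z * h = unif powi n * g" "g \<noteq> 0" "h \<noteq> 0"
      using zn(3) by (rule has_ordE)
    have gh: "val v g = 0" "val v h = 0" "g \<in> FF" "h \<in> FF" using 1 U_zero R_sub_FF by auto
    have pw: "val v (unif ^ k) = int k * val v unif" "unif ^ k \<in> FF" for k using val_power[OF v] by auto
    have zh: "val v (z * h) = val v z" using mult[OF that(1,2) gh(4) 1(7)] gh by simp
    from power_int_eq_cases[OF unif(3) 1(5)] show ?thesis
    proof (elim disjE conjE)
      assume "0 \<le> n" "z * h = unif ^ nat n * g"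
      thus ?thesis using mult[OF pw(2) _ gh(3) 1(6), of "nat n"] zh gh pw by simp
    next
      assume "n < 0" "z * h * unif ^ nat (- n) = g"
      thus ?thesis using mult[OF FF_closed(1)[OF that(1) gh(4)] _ pw(2), of "nat (- n)"] zh gh pw(1) 1(7) zn(2)
        by simp
    qed
  qed
  \<comment> \<open>Normalization: the value 1 is a multiple of the positive integer
    \<open>val v unif\<close>, which must therefore be 1.\<close>
  obtain w where w: "w \<in> FF" "w \<noteq> 0" "val v w = 1" using v by (auto simp: ec_valuation_iff)
  then obtain k where "has_ord w k" using has_ord_exists by blast
  hence "k * val v unif = 1" using ord w by metis
  moreover have "0 < val v unif" using M_pos[of unif] by simp
  ultimately have "val v unif = 1" using pos_zmult_eq_1_iff by (metis mult.commute)
  thus ?thesis using ord[OF z] by simp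
qed

theorem ec_ord_affine:
  assumes "f \<noteq> (0, 0)" shows "has_ord (ffun f) (ec_ord a b (Affine x0 y0) f)"
proof (rule ec_ord_eqI[where H = has_ord])
  fix z z' n m assume *: "has_ord z n" "has_ord z' m" "z + z' \<noteq> 0"
  show "\<exists>l\<ge>min n m. has_ord (z + z') l"
  proof (cases "n \<le> m")
    case True
    thus ?thesis using has_ord_add[OF *(1,2) _ *(3)] by simp
  next
    case False
    thus ?thesis using has_ord_add[OF *(2,1)] *(3) by (simp add: add.commute)
  qed
next
  fix v assume v: "\<And>f n. f \<noteq> (0, 0) \<Longrightarrow> has_ord (ffun f) n \<Longrightarrow> v f = n"
  have "f = \<zero>\<^bsub>K\<^esub> \<or> 0 < v f" if fR: "ffun f \<in> R" "e (ffun f) = 0" for f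
  proof (cases "f = (0, 0)")
    case False
    then obtain n where n: "has_ord (ffun f) n" using has_ord_exists_R[OF fR(1)] ffun_eq_0_iff by blast
    thus ?thesis using v[OF False n] has_ord_R[OF n fR(1)] fR(2) by force
  qed simp
  from this[of "ec_x \<ominus>\<^bsub>K\<^esub> ec_const x0"] this[of "ec_y \<ominus>\<^bsub>K\<^esub> ec_const y0"]
  show "ec_centred_at a b v (Affine x0 y0)" by (simp add: Let_def)
next
  show "\<exists>z\<in>FF - {0}. has_ord z 1" using has_ord_unif by (intro bexI[of _ unif]) simp_all
next
  show "has_ord (cf c) 0" if "c \<noteq> 0" for c using that by (intro has_ord_unit) auto
next
  show "\<exists>n. has_ord z n" if "z \<in> FF" "z \<noteq> 0" for z using that by (rule has_ord_exists)
  show "n = m" if "z \<noteq> 0" "has_ord z n" "has_ord z m" for z n m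
    using has_ord_unique[OF that(2,3,1)] .
  show "has_ord (z * z') (n + m)" if "has_ord z n" "has_ord z' m" for z z' n m
    using that by (rule has_ord_mult)
  show "val v z = n" if "ec_valuation a b v" "ec_centred_at a b v (Affine x0 y0)" "z \<in> FF" "z \<noteq> 0"
    "has_ord z n" for v z n using that by (rule val_affine)
  show "f \<noteq> (0, 0)" by (rule assms)
qed

text \<open>The function f minus c has positive order at the point exactly if it vanishes there,
  which singles out c as the value under evaluation.\<close>

lemma ec_value_affine:
  assumes "ffun f \<in> R" shows "ec_value a b f (Affine x0 y0) = e (ffun f)"
  unfolding ec_value_def Let_def
proof (rule the_equality)
  have *: "f \<ominus>\<^bsub>K\<^esub> ec_const c = \<zero>\<^bsub>K\<^esub> \<or> 0 < ec_ord a b (Affine x0 y0) (f \<ominus>\<^bsub>K\<^esub> ec_const c) \<longleftrightarrow> e (ffun f) = c" for c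
  proof (cases "f \<ominus>\<^bsub>K\<^esub> ec_const c = \<zero>\<^bsub>K\<^esub>")
    case True
    hence "ffun (f \<ominus>\<^bsub>K\<^esub> ec_const c) = 0" by simp
    hence "ffun f = cf c" by simp
    thus ?thesis using True by simp
  next
    case False
    hence o: "has_ord (ffun (f \<ominus>\<^bsub>K\<^esub> ec_const c)) (ec_ord a b (Affine x0 y0) (f \<ominus>\<^bsub>K\<^esub> ec_const c))"
      by (intro ec_ord_affine) simp
    have R: "ffun (f \<ominus>\<^bsub>K\<^esub> ec_const c) \<in> R" using assms by simp
    have "e (ffun (f \<ominus>\<^bsub>K\<^esub> ec_const c)) = e (ffun f) - c" using assms by simp
    thus ?thesis using has_ord_R[OF o R] False by auto
  qed
  show "f \<ominus>\<^bsub>K\<^esub> ec_const (e (ffun f)) = \<zero>\<^bsub>K\<^esub> \<or> 0 < ec_ord a b (Affine x0 y0) (f \<ominus>\<^bsub>K\<^esub> ec_const (e (ffun f)))"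
    using *[of "e (ffun f)"] by blast
  show "f \<ominus>\<^bsub>K\<^esub> ec_const c = \<zero>\<^bsub>K\<^esub> \<or> 0 < ec_ord a b (Affine x0 y0) (f \<ominus>\<^bsub>K\<^esub> ec_const c) \<Longrightarrow> c = e (ffun f)" for c
    using *[of c] by metis
qed

end


section \<open>The order at the point at infinity\<close>

definition has_ord_inf :: "'k poly fract alg_closure \<Rightarrow> int \<Rightarrow> bool" where
  "has_ord_inf f n \<longleftrightarrow> (\<exists>q. q \<noteq> 0 \<and> f * emb q \<in> R \<and> f \<noteq> 0 \<and>
     n = 2 * int (degree q) - int (degree (nrm (f * emb q))))"

lemma degree_nrm_mult:
  assumes "z \<in> R" "z' \<in> R" "z \<noteq> 0" "z' \<noteq> 0"
  shows "degree (nrm (z * z')) = degree (nrm z) + degree (nrm z')"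
  using assms by (simp add: nrm_mult degree_mult_eq nrm_eq_0_iff)

lemma degree_nrm_mult_emb:
  assumes "z \<in> R" "z \<noteq> 0" "q \<noteq> 0"
  shows "degree (nrm (z * emb q)) = degree (nrm z) + 2 * degree q"
  using assms by (simp add: degree_nrm_mult nrm_emb degree_sq)

lemma degree_nrm_Y: "degree (nrm Y) = 3" and degree_nrm_emb: "degree (nrm (emb p)) = 2 * degree p"
  by (simp_all add: Y_conv_el degree_nrm nrm_emb degree_sq)

lemma has_ord_inf_exists:
  assumes "f \<in> FF" "f \<noteq> 0" shows "\<exists>n. has_ord_inf f n"
proof -
  obtain q z where "q \<noteq> 0" "z \<in> R" "f * emb q = z" using assms FF_denominator by metis
  thus ?thesis using assms(2) unfolding has_ord_inf_def by auto
qed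

text \<open>The choice of denominator is immaterial: an extra factor r adds 2 deg r both to the
  denominator term and to the degree of the norm.\<close>

lemma has_ord_inf_unique:
  assumes "has_ord_inf f n" "has_ord_inf f m" shows "n = m"
proof -
  obtain q where q: "q \<noteq> 0" "f * emb q \<in> R" "f \<noteq> 0" "n = 2 * int (degree q) - int (degree (nrm (f * emb q)))"
    using assms(1) unfolding has_ord_inf_def by auto
  obtain r where r: "r \<noteq> 0" "f * emb r \<in> R" "m = 2 * int (degree r) - int (degree (nrm (f * emb r)))"
    using assms(2) unfolding has_ord_inf_def by auto
  have "(f * emb q) * emb r = (f * emb r) * emb q" by (simp only: mult_ac)
  hence "degree (nrm ((f * emb q) * emb r)) = degree (nrm ((f * emb r) * emb q))" by (simp only:)
  thus ?thesis
    using degree_nrm_mult_emb[OF q(2) _ r(1)] degree_nrm_mult_emb[OF r(2) _ q(1)] q r by simp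
qed

lemma has_ord_inf_mult:
  assumes "has_ord_inf f n" "has_ord_inf g m" shows "has_ord_inf (f * g) (n + m)"
proof -
  obtain q where q: "q \<noteq> 0" "f * emb q \<in> R" "f \<noteq> 0" "n = 2 * int (degree q) - int (degree (nrm (f * emb q)))"
    using assms(1) unfolding has_ord_inf_def by auto
  obtain r where r: "r \<noteq> 0" "g * emb r \<in> R" "g \<noteq> 0" "m = 2 * int (degree r) - int (degree (nrm (g * emb r)))"
    using assms(2) unfolding has_ord_inf_def by auto
  have eq: "f * g * emb (q * r) = (f * emb q) * (g * emb r)" by (simp add: mult_ac)
  have "f * emb q \<noteq> 0" "g * emb r \<noteq> 0" using q(1,3) r(1,3) by auto
  hence "degree (nrm (f * g * emb (q * r))) = degree (nrm (f * emb q)) + degree (nrm (g * emb r))"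
    unfolding eq using q(2) r(2) by (intro degree_nrm_mult)
  moreover have "f * g * emb (q * r) \<in> R" unfolding eq using q(2) r(2) by (rule R_closed(4))
  moreover have "degree (q * r) = degree q + degree r" using q(1) r(1) by (rule degree_mult_eq)
  ultimately show ?thesis
    unfolding has_ord_inf_def using q r by (intro exI[of _ "q * r"]) simp
qed

lemma has_ord_inf_add:
  assumes "has_ord_inf f n" "has_ord_inf g m" "f + g \<noteq> 0"
  shows "\<exists>l \<ge> min n m. has_ord_inf (f + g) l"
proof -
  obtain q where q: "q \<noteq> 0" "f * emb q \<in> R" "f \<noteq> 0" "n = 2 * int (degree q) - int (degree (nrm (f * emb q)))"
    using assms(1) unfolding has_ord_inf_def by auto
  obtain r where r: "r \<noteq> 0" "g * emb r \<in> R" "g \<noteq> 0" "m = 2 * int (degree r) - int (degree (nrm (g * emb r)))"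
    using assms(2) unfolding has_ord_inf_def by auto
  have ne: "f * emb q \<noteq> 0" "g * emb r \<noteq> 0" using q(1,3) r(1,3) by auto
  have eq: "(f + g) * emb (q * r) = (f * emb q) * emb r + (g * emb r) * emb q"
    by (simp add: algebra_simps)
  have RR: "(f * emb q) * emb r \<in> R" "(g * emb r) * emb q \<in> R" using q(2) r(2) by (simp_all only: R_closed R_basic)
  note d = degree_nrm_mult_emb[OF q(2) ne(1) r(1)] degree_nrm_mult_emb[OF r(2) ne(2) q(1)]
  have "degree (nrm ((f + g) * emb (q * r)))
      \<le> max (degree (nrm (f * emb q)) + 2 * degree r) (degree (nrm (g * emb r)) + 2 * degree q)"
    using degree_nrm_add[OF RR] unfolding eq d .
  hence "min n m \<le> 2 * int (degree (q * r)) - int (degree (nrm ((f + g) * emb (q * r))))"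
    using q(4) r(4) degree_mult_eq[OF q(1) r(1)] by linarith
  moreover have "(f + g) * emb (q * r) \<in> R" unfolding eq using RR by (rule R_closed(1))
  ultimately show ?thesis
    unfolding has_ord_inf_def using assms(3) q(1) r(1)
    by (intro exI[of _ "2 * int (degree (q * r)) - int (degree (nrm ((f + g) * emb (q * r))))"] conjI exI[of _ "q * r"]) auto
qed

lemma has_ord_inf_R:
  assumes "z \<in> R" "z \<noteq> 0" shows "has_ord_inf z (- int (degree (nrm z)))"
  unfolding has_ord_inf_def using assms by (intro exI[of _ 1]) auto

text \<open>The curve equation forces 2 v(y) = 3 v(x), so v(x) = -2m and v(y) = -3m for some m > 0.
  Even and odd multiples of m never tie, hence \<open>v\<close> is m times the order at O, and
  normalization gives m = 1.\<close>

lemma val_infinity: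
  assumes v: "ec_valuation a b v" and c: "ec_centred_at a b v Infinity"
    and f: "f \<in> FF" "has_ord_inf f n"
  shows "val v f = n"
proof -
  note mult = val_mult[OF v] and add = val_add_ge[OF v] and const = val_const[OF v]
  let ?x = "val v (xf 0)" and ?y = "val v Y"
  have xy: "?y < ?x" "?y < 0"
    using c unfolding ec_centred_at.simps val_ffun[symmetric] ffun_x ffun_y by auto
  have FF: "xf 0 \<in> FF" "Y \<in> FF" "emb p \<in> FF" for p using R_sub_FF by auto
  have Ysq: "val v (emb cubic) = 2 * ?y"
    using mult[OF FF(2) _ FF(2)] by (simp add: Y_mult_Y)
  \<comment> \<open>If x had nonnegative value, so would every polynomial in x, in particular the
    cubic, which is the square of \<open>Y\<close>.\<close>
  have x_neg: "?x < 0"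
  proof (rule ccontr)
    assume *: "\<not> ?x < 0"
    have "emb p = 0 \<or> 0 \<le> val v (emb p)" for p
    proof (rule emb_induct[of "\<lambda>z. z = 0 \<or> 0 \<le> val v z" 0])
      show "cf c = 0 \<or> 0 \<le> val v (cf c)" for c using const[of c] by (cases "c = 0") auto
      fix q c assume q: "emb q = 0 \<or> 0 \<le> val v (emb q)"
      have "xf 0 * emb q = 0 \<or> 0 \<le> val v (xf 0 * emb q)"
        using q mult[of "xf 0" "emb q"] * R_sub_FF by (cases "q = 0") auto
      moreover have "cf c = 0 \<or> 0 \<le> val v (cf c)" using const[of c] by (cases "c = 0") auto
      ultimately show "cf c + xf 0 * emb q = 0 \<or> 0 \<le> val v (cf c + xf 0 * emb q)"
        using add[of "cf c" "xf 0 * emb q" 0] R_sub_FF by blast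
    qed
    from this[of cubic] show False using Ysq xy by simp
  qed
  have poly: "val v (emb p) = int (degree p) * ?x" if "p \<noteq> 0" for p
    using that
  proof (induction p)
    case (pCons c p)
    have eq: "emb (pCons c p) = xf 0 * emb p + cf c" by (simp flip: emb_simps add: lin_def)
    show ?case
    proof (cases "p = 0")
      case True
      thus ?thesis using const[of c] pCons by auto
    next
      case False
      hence m: "val v (xf 0 * emb p) = ?x + int (degree p) * ?x" using mult[OF FF(1) _ FF(3)] pCons by simp
      have "val v (xf 0 * emb p) < 0" unfolding m
        using x_neg by (simp add: add_neg_nonpos mult_nonneg_nonpos)
      hence "cf c = 0 \<or> val v (xf 0 * emb p) < val v (cf c)" using const[of c] by (cases "c = 0") auto
      hence "val v (xf 0 * emb p + cf c) = val v (xf 0 * emb p)"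
        using False by (intro val_add_eq(2)[OF v] FF FF_closed(1)) auto
      thus ?thesis unfolding eq m using False by (simp add: algebra_simps)
    qed
  qed simp
  \<comment> \<open>The value of x/y, which is a local parameter at O.\<close>
  define m where "m = ?x - ?y"
  have m: "?x = - 2 * m" "?y = - 3 * m" using Ysq poly[of cubic] by (auto simp: m_def)
  have m_pos: "0 < m" using xy by (simp add: m_def)
  have RR: "val v z = - m * int (degree (nrm z))" if zR: "z \<in> R" "z \<noteq> 0" for z
  proof -
    obtain p q where z: "z = el p q" using zR by (auto elim: R_cases)
    have p: "val v (emb p) = - m * int (2 * degree p)" if "p \<noteq> 0" using poly[OF that] m by simp
    have q: "val v (emb q * Y) = - m * int (2 * degree q + 3)" if "q \<noteq> 0"
      using poly[OF that] m mult[OF FF(3) _ FF(2), of q] that by (simp add: algebra_simps)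
    show ?thesis
    proof (cases "p = 0 \<or> q = 0")
      case True
      thus ?thesis using p q zR by (auto simp: z degree_nrm) (auto simp: el_def)
    next
      case False
      hence dz: "degree (nrm z) = max (2 * degree p) (2 * degree q + 3)" by (simp add: z degree_nrm)
      have pq: "emb p \<noteq> 0" "emb q * Y \<noteq> 0" using False by auto
      have "2 * degree p \<noteq> 2 * degree q + 3" by presburger
      hence "2 * degree p < 2 * degree q + 3 \<or> 2 * degree q + 3 < 2 * degree p" by linarith
      thus ?thesis
      proof
        assume *: "2 * degree p < 2 * degree q + 3"
        hence "val v (emb q * Y) < val v (emb p)" using p q False m_pos by simp
        hence "val v (emb q * Y + emb p) = val v (emb q * Y)"
          using pq by (intro val_add_eq(2)[OF v] FF FF_closed(1)) auto
        hence "val v z = val v (emb q * Y)" by (simp add: z el_def add.commute)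
        thus ?thesis using * q False dz by simp
      next
        assume *: "2 * degree q + 3 < 2 * degree p"
        hence "val v (emb p) < val v (emb q * Y)" using p q False m_pos by simp
        hence "val v (emb p + emb q * Y) = val v (emb p)"
          using pq by (intro val_add_eq(2)[OF v] FF FF_closed(1)) auto
        hence "val v z = val v (emb p)" by (simp add: z el_def)
        thus ?thesis using * p False dz by simp
      qed
    qed
  qed
  have ord: "val v f = m * n" if fn: "f \<in> FF" "has_ord_inf f n" for f n
  proof -
    obtain q where q: "q \<noteq> 0" "f * emb q \<in> R" "f \<noteq> 0" "n = 2 * int (degree q) - int (degree (nrm (f * emb q)))"
      using fn(2) unfolding has_ord_inf_def by auto
    have "val v (f * emb q) = val v f + val v (emb q)" using mult[OF fn(1) q(3) FF(3)] q(1) by simp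
    thus ?thesis using RR[OF q(2)] q(1,3) poly[OF q(1)] m by (simp add: q(4) algebra_simps)
  qed
  obtain w where w: "w \<in> FF" "w \<noteq> 0" "val v w = 1" using v by (auto simp: ec_valuation_iff)
  then obtain k where "has_ord_inf w k" using has_ord_inf_exists by blast
  hence "m * k = 1" using ord w by metis
  hence "m = 1" using m_pos pos_zmult_eq_1_iff by blast
  thus ?thesis using ord[OF f] by simp
qed

lemma ec_ord_infinity:
  assumes "f \<noteq> (0, 0)" shows "has_ord_inf (ffun f) (ec_ord a b Infinity f)"
proof (rule ec_ord_eqI[where H = has_ord_inf])
  show "\<exists>n. has_ord_inf z n" if "z \<in> FF" "z \<noteq> 0" for z using that by (rule has_ord_inf_exists)
  show "n = m" if "has_ord_inf z n" "has_ord_inf z m" for z n m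
    using that by (rule has_ord_inf_unique)
  show "has_ord_inf (z * z') (n + m)" if "has_ord_inf z n" "has_ord_inf z' m" for z z' n m
    using that by (rule has_ord_inf_mult)
  show "\<exists>l\<ge>min n m. has_ord_inf (z + z') l" if "has_ord_inf z n" "has_ord_inf z' m" "z + z' \<noteq> 0"
    for z z' n m using that by (rule has_ord_inf_add)
  show "has_ord_inf (cf c) 0" if "c \<noteq> 0" for c
    using has_ord_inf_R[of "cf c"] that by (simp add: degree_nrm_emb)
  show "val v z = n" if "ec_valuation a b v" "ec_centred_at a b v Infinity" "z \<in> FF" "has_ord_inf z n"
    for v z n using that by (rule val_infinity)
  show "f \<noteq> (0, 0)" by (rule assms)
  fix v assume v: "\<And>f n. f \<noteq> (0, 0) \<Longrightarrow> has_ord_inf (ffun f) n \<Longrightarrow> v f = n"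
  have "ec_y \<noteq> (0 :: 'k poly fract, 0)" "ec_x \<noteq> (0 :: 'k poly fract, 0)" by (simp_all add: ec_x_def ec_y_def)
  moreover have "has_ord_inf (ffun ec_y) (- 3)" "has_ord_inf (ffun ec_x) (- 2)"
    using has_ord_inf_R[of Y] has_ord_inf_R[of "xf 0"]
    by (simp_all add: ffun_x degree_nrm_Y degree_nrm_emb)
  ultimately have "v ec_y = - 3" "v ec_x = - 2" using v by blast+
  thus "ec_centred_at a b v Infinity" by simp
next
  \<comment> \<open>This is x/y with the denominator made a polynomial, x y / cubic; its order is 2
    * 3 - 5 = 1.\<close>
  define z where "z = ffun (0, to_fract (lin 0) / to_fract cubic)"
  have z: "z * emb cubic = xf 0 * Y" by (simp add: z_def ffun_def emb_def)
  hence "z \<noteq> 0" by auto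
  have "degree (nrm (xf 0 * Y)) = 5" by (simp add: degree_nrm_mult degree_nrm_emb degree_nrm_Y)
  hence "has_ord_inf z 1" unfolding has_ord_inf_def using z \<open>z \<noteq> 0\<close> by (intro exI[of _ cubic]) auto
  thus "\<exists>z\<in>FF - {0}. has_ord_inf z 1" using \<open>z \<noteq> 0\<close> by (intro bexI[of _ z]) (auto simp: FF_def z_def)
qed

text \<open>If a denominator of minimal degree had a root $x$, both points above $x$ would force a
  common factor into the numerator.\<close>

lemma regular_imp_R:
  assumes alg: "\<And>p :: 'k poly. 0 < degree p \<Longrightarrow> \<exists>x. poly p x = 0"
    and f: "f \<in> FF"
    and reg: "\<And>x y. on_curve x y \<Longrightarrow> \<exists>h\<in>R. ev x y h \<noteq> 0 \<and> f * h \<in> R"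
  shows "f \<in> R"
proof -
  have "q \<noteq> 0 \<Longrightarrow> f * emb q \<in> R \<Longrightarrow> f \<in> R" for q
  proof (induction "degree q" arbitrary: q rule: less_induct)
    case less
    show ?case
    proof (cases "degree q = 0")
      case True
      then obtain c where q: "q = [:c:]" "c \<noteq> 0" using less(2) by (auto elim: degree_eq_zeroE)
      have "cf c * cf (inverse c) = 1" using q(2) by (simp flip: cf_simps(3)) (simp add: cf_simps)
      hence "f = (f * emb q) * cf (inverse c)" by (simp add: q(1) mult.assoc)
      thus ?thesis using less(3) by (metis R_closed(4) R_basic(1))
    next
      case False
      then obtain x where x: "poly q x = 0" using alg by auto
      \<comment> \<open>A point of the curve above x: y is a root of T^2 - (x^3 + a x + b).\<close>
      have "degree [:- (x ^ 3 + a * x + b), 0, 1:] > 0" by simp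
      then obtain y where "poly [:- (x ^ 3 + a * x + b), 0, 1:] y = 0" using alg by blast
      hence "y * y - (x ^ 3 + a * x + b) = 0" by (simp add: algebra_simps)
      hence oc: "on_curve x y" unfolding on_curve_def power2_eq_square eq_iff_diff_eq_0[of "y * y"] .
      hence oc': "on_curve x (- y)" by simp
      obtain p r where z: "f * emb q = el p r" using less(3) by (auto elim: R_cases)
      \<comment> \<open>The numerator p + r Y equals f times q; f is regular at the point and q
        vanishes there, so the numerator vanishes too.\<close>
      have zero: "poly p x + poly r x * y' = 0" if c: "on_curve x y'" for y'
      proof -
        obtain h where h: "h \<in> R" "ev x y' h \<noteq> 0" "f * h \<in> R" using reg[OF c] by blast
        have "el p r * h = (f * h) * emb q" unfolding z[symmetric] by (simp only: mult_ac)
        hence "ev x y' (el p r * h) = ev x y' ((f * h) * emb q)" by (simp only:)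
        hence "ev x y' (el p r) * ev x y' h = 0" 
          using ev_mult[OF c el_in_R h(1)] ev_mult[OF c h(3) R_basic(1)] x by simp
        thus ?thesis using h(2) by (simp add: ev_el)
      qed
      have "(poly p x + poly r x * y) + (poly p x + poly r x * (- y)) = 0"
        unfolding zero[OF oc] zero[OF oc'] by simp
      hence "2 * poly p x = 0" by simp
      hence p0: "poly p x = 0" using two by simp
      then obtain p' where p': "p = lin x * p'" unfolding poly_eq_0_iff_dvd lin_def by (elim dvdE)
      obtain q' where q': "q = lin x * q'" using x unfolding poly_eq_0_iff_dvd lin_def by (elim dvdE)
      \<comment> \<open>For y = 0 the two points above x coincide and \<open>zero\<close> yields
        p(x) = 0 only. Then Y^2 = (X - x) s with s(x) \<noteq> 0 lets one factor X - x be cancelled,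
        leaving r s h as a multiple of Y.\<close>
      have "poly r x = 0"
      proof (cases "y = 0")
        case False
        thus ?thesis using zero[OF oc] p0 by simp
      next
        case True
        obtain s where "(Y - cf y) * (Y + cf y) = xf x * emb s" "poly s x \<noteq> 0"
          using Y_sq_minus[OF oc] True by metis
        hence s: "Y * Y = xf x * emb s" "poly s x \<noteq> 0" using True by (auto simp: cf_simps)
        obtain h where h: "h \<in> R" "ev x y h \<noteq> 0" "f * h \<in> R" using reg[OF oc] by blast
        have rY: "emb r * Y = xf x * (f * emb q' - emb p')"
          using z unfolding p' q' el_def by (simp add: algebra_simps)
        have "xf x * (emb s * emb r * h) = (emb r * (Y * Y)) * h"
          unfolding s(1) by (simp only: mult_ac)
        also have "\<dots> = (emb r * Y) * Y * h" by (simp only: mult_ac)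
        also have "\<dots> = xf x * (Y * (f * h * emb q' - emb p' * h))" unfolding rY by (simp add: algebra_simps)
        finally have "emb s * emb r * h = Y * (f * h * emb q' - emb p' * h)" by simp
        hence "ev x y (emb s * emb r * h) = ev x y (Y * (f * h * emb q' - emb p' * h))" by (simp only:)
        also have "\<dots> = 0" 
          using ev_mult[OF oc R_basic(2), of "f * h * emb q' - emb p' * h"] h True
          by (simp only: R_basic R_closed ev_basic mult_zero_left)
        also have "ev x y (emb s * emb r * h) = poly s x * poly r x * ev x y h" using oc h by simp
        finally show ?thesis using s(2) h(2) by simp
      qed
      then obtain r' where r': "r = lin x * r'" unfolding poly_eq_0_iff_dvd lin_def by (elim dvdE)
      have "xf x * (f * emb q') = xf x * el p' r'"
        using z unfolding p' q' r' by (simp add: el_def algebra_simps)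
      hence "f * emb q' \<in> R" by simp
      moreover have "q' \<noteq> 0" using less(2) q' by auto
      moreover have "degree q' < degree q" unfolding q' using \<open>q' \<noteq> 0\<close> by (simp add: degree_mult_eq)
      ultimately show ?thesis using less(1) by blast
    qed
  qed
  moreover obtain q where "q \<noteq> 0" "f * emb q \<in> R" using f FF_denominator by metis
  ultimately show ?thesis by blast
qed

lemma has_ord_regular:
  assumes oc: "on_curve x y" and "has_ord x y f n" "0 \<le> n"
  shows "\<exists>h\<in>R. ev x y h \<noteq> 0 \<and> f * h \<in> R"
proof -
  obtain g h where 1: "g \<in> R" "h \<in> R" "ev x y h \<noteq> 0" "f * h = unif x y powi n * g"
    using assms by (blast elim: has_ordE)
  have "unif x y powi n = unif x y ^ nat n" using assms(3) by (simp add: power_int_def)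
  hence "f * h \<in> R" unfolding 1(4) using 1 unif[OF oc] by (simp add: R_power R_closed)
  thus ?thesis using 1 by blast
qed

text \<open>The affine points force f into the coordinate ring, which needs \<open>alg\<close>;
  there the order at O is minus the degree of the norm.\<close>

lemma div_bound_iff:
  assumes alg: "\<And>p :: 'k poly. 0 < degree p \<Longrightarrow> \<exists>x. poly p x = 0" and f: "f \<noteq> (0, 0)"
  shows "(\<forall>P. - (int k * point_divisor Infinity P) \<le> ec_div a b f P) \<longleftrightarrow>
    (\<exists>u v. f = (to_fract u, to_fract v) \<and> degree (nrm (el u v)) \<le> k)"
proof
  assume *: "\<forall>P. - (int k * point_divisor Infinity P) \<le> ec_div a b f P"
  have "ffun f \<in> R"
  proof (rule regular_imp_R[OF alg])
    fix x y assume oc: "on_curve x y"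
    hence "0 \<le> ec_ord a b (Affine x y) f"
      using *[rule_format, of "Affine x y"] by (simp add: ec_div_def on_curve_iff point_divisor_def)
    thus "\<exists>h\<in>R. ev x y h \<noteq> 0 \<and> ffun f * h \<in> R" using has_ord_regular oc ec_ord_affine f by blast
  qed (simp_all add: FF_def)
  then obtain u v where uv: "ffun f = el u v" by (auto elim: R_cases)
  hence fuv: "f = (to_fract u, to_fract v)" by (simp add: el_conv_ffun)
  have "el u v \<noteq> 0" using f uv ffun_eq_0_iff by metis
  hence "has_ord_inf (ffun f) (- int (degree (nrm (el u v))))" unfolding uv by (intro has_ord_inf_R) auto
  hence "ec_ord a b Infinity f = - int (degree (nrm (el u v)))"
    using has_ord_inf_unique ec_ord_infinity f by blast
  moreover have "- int k \<le> ec_ord a b Infinity f"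
    using *[rule_format, of Infinity] by (simp add: ec_div_def ec_points_def point_divisor_def)
  ultimately show "\<exists>u v. f = (to_fract u, to_fract v) \<and> degree (nrm (el u v)) \<le> k" using fuv by auto
next
  assume "\<exists>u v. f = (to_fract u, to_fract v) \<and> degree (nrm (el u v)) \<le> k"
  then obtain u v where fuv: "f = (to_fract u, to_fract v)" "degree (nrm (el u v)) \<le> k" by blast
  hence uv: "ffun f = el u v" by (simp add: el_conv_ffun)
  have "el u v \<noteq> 0" using f uv ffun_eq_0_iff by metis
  hence "has_ord_inf (ffun f) (- int (degree (nrm (el u v))))" unfolding uv by (intro has_ord_inf_R) auto
  hence inf: "ec_ord a b Infinity f = - int (degree (nrm (el u v)))"
    using has_ord_inf_unique ec_ord_infinity f by blast
  have aff: "0 \<le> ec_ord a b (Affine x y) f" if "on_curve x y" for x y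
    using has_ord_R(1)[OF that ec_ord_affine[OF that f]] uv by simp
  show "\<forall>P. - (int k * point_divisor Infinity P) \<le> ec_div a b f P"
  proof
    fix P
    show "- (int k * point_divisor Infinity P) \<le> ec_div a b f P"
      using inf fuv(2) aff
      by (cases P) (auto simp: ec_div_def point_divisor_def on_curve_iff)
  qed
qed

end

section \<open>Functions over the base field\<close>

abbreviation ac_poly :: "'a::field poly \<Rightarrow> 'a alg_closure poly" where
  "ac_poly \<equiv> map_poly to_ac"

lemma ac_poly_add: "ac_poly (p + q) = ac_poly p + ac_poly q"
  by (rule poly_eqI) (simp add: coeff_map_poly)

lemma ac_poly_mult: "ac_poly (p * q) = ac_poly p * ac_poly q"
proof (induction p)
  case (pCons c p)
  have "ac_poly (smult c q) = smult (to_ac c) (ac_poly q)" by (rule poly_eqI) (simp add: coeff_map_poly)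
  thus ?case using pCons by (simp add: map_poly_pCons ac_poly_add)
qed simp

lemma ac_poly_eq_0_iff [simp]: "ac_poly p = 0 \<longleftrightarrow> p = 0"
  by (rule map_poly_eq_0_iff) auto

lemma degree_ac_poly [simp]: "degree (ac_poly p) = degree p"
  by (rule degree_map_poly) auto

lemma poly_ac_poly [simp]: "poly (ac_poly p) (to_ac x) = to_ac (poly p x)"
  by (induction p) (simp_all add: map_poly_pCons)

text \<open>Division with remainder over the base field already gives the quotient: the product of U
  - p div q with q equals p mod q, whose degree is too small unless the first factor is
  zero.\<close>

lemma to_fract_in_base_ratfuns_iff: "to_fract U \<in> base_ratfuns \<longleftrightarrow> U \<in> range ac_poly"
proof
  assume "to_fract U \<in> base_ratfuns"
  then obtain p q where pq: "to_fract U = to_fract (ac_poly p) / to_fract (ac_poly q)" "q \<noteq> 0"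
    by (auto simp: base_ratfuns_def)
  hence "to_fract (U * ac_poly q) = to_fract (ac_poly p)" by (simp add: field_simps)
  hence "U * ac_poly q = ac_poly p" by (simp only: to_fract_eq_iff)
  also have "\<dots> = ac_poly (p div q * q + p mod q)" by (simp only: div_mult_mod_eq)
  finally have "U * ac_poly q = ac_poly (p div q * q + p mod q)" .
  hence eq: "(U - ac_poly (p div q)) * ac_poly q = ac_poly (p mod q)"
    unfolding ac_poly_add ac_poly_mult by (simp add: algebra_simps)
  have "U - ac_poly (p div q) = 0"
  proof (rule ccontr)
    assume ne: "U - ac_poly (p div q) \<noteq> 0"
    hence "degree ((U - ac_poly (p div q)) * ac_poly q) = degree (U - ac_poly (p div q)) + degree q"
      using pq(2) by (subst degree_mult_eq) auto
    hence "degree q \<le> degree (p mod q)" unfolding eq by simp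
    moreover have "p mod q \<noteq> 0" using eq ne pq(2) by auto
    ultimately show False using degree_mod_less[OF pq(2), of p] by auto
  qed
  thus "U \<in> range ac_poly" by auto
next
  assume "U \<in> range ac_poly"
  then obtain u where "U = ac_poly u" by blast
  moreover have "ac_poly (1 :: 'a poly) = 1" by simp
  ultimately show "to_fract U \<in> base_ratfuns"
    unfolding base_ratfuns_def by (intro CollectI exI[of _ u] exI[of _ 1]) (simp only:, simp)
qed

text \<open>The pole bound in terms of coefficients, so that it reads the same over the base field
  and over its closure. The zero polynomial is separate because its degree is 0 by
  convention.\<close>

definition deg_le :: "nat \<Rightarrow> 'a::field poly \<Rightarrow> 'a poly \<Rightarrow> bool" where
  "deg_le k u v \<longleftrightarrow> 2 * degree u \<le> k \<and> (v = 0 \<or> 2 * degree v + 3 \<le> k)"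

lemma (in weierstrass) degree_nrm_le_iff: "degree (nrm (el u v)) \<le> k \<longleftrightarrow> deg_le k u v"
  by (auto simp: degree_nrm deg_le_def)

lemma (in weierstrass) ac_weierstrass: "weierstrass (to_ac a) (to_ac b)"
proof
  have "(2 :: 'k alg_closure) = to_ac 2" by simp
  thus "(2 :: 'k alg_closure) \<noteq> 0" using two by (metis to_ac_eq_0_iff)
  have "4 * to_ac a ^ 3 + 27 * to_ac b ^ 2 = to_ac (4 * a ^ 3 + 27 * b ^ 2)" by simp
  thus "ec_nonsingular (to_ac a) (to_ac b)"
    using nonsingular unfolding ec_nonsingular_def by (metis to_ac_eq_0_iff)
qed

lemma (in weierstrass) RR_space_eq:
  "RR_space a b (\<lambda>Q. int k * point_divisor Infinity Q) =
    {(to_fract (ac_poly u), to_fract (ac_poly v)) | u v. deg_le k u v}"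
proof -
  interpret K: weierstrass "to_ac a" "to_ac b" by (rule ac_weierstrass)
  have alg: "0 < degree p \<Longrightarrow> \<exists>x. poly p x = 0" for p :: "'k alg_closure poly"
    by (rule alg_closed_imp_poly_has_root)
  have deg: "degree (K.nrm (K.el (ac_poly u) (ac_poly v))) \<le> k \<longleftrightarrow> deg_le k u v" for u v
    unfolding K.degree_nrm_le_iff deg_le_def by simp
  have "f \<in> RR_space a b (\<lambda>Q. int k * point_divisor Infinity Q) \<longleftrightarrow>
      (\<exists>u v. f = (to_fract (ac_poly u), to_fract (ac_poly v)) \<and> deg_le k u v)" for f
  proof (cases "f = (0, 0)")
    case True
    thus ?thesis by (auto simp: RR_space_def deg_le_def intro!: exI[of _ 0])
  next
    case False
    hence "f \<in> RR_space a b (\<lambda>Q. int k * point_divisor Infinity Q) \<longleftrightarrow>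
      f \<in> base_ec_funs \<and> (\<exists>U V. f = (to_fract U, to_fract V) \<and> degree (K.nrm (K.el U V)) \<le> k)"
      by (simp add: RR_space_def K.div_bound_iff[OF alg False])
    also have "\<dots> \<longleftrightarrow> (\<exists>U V. f = (to_fract U, to_fract V) \<and> U \<in> range ac_poly \<and> V \<in> range ac_poly \<and>
        degree (K.nrm (K.el U V)) \<le> k)"
      by (auto simp: base_ec_funs_def to_fract_in_base_ratfuns_iff)
    also have "\<dots> \<longleftrightarrow> (\<exists>u v. f = (to_fract (ac_poly u), to_fract (ac_poly v)) \<and> deg_le k u v)"
      using deg by blast
    finally show ?thesis .
  qed
  thus ?thesis by blast
qed

lemma (in weierstrass) ec_value_base:
  assumes "on_curve x y"
  shows "ec_value (to_ac a) (to_ac b) (to_fract (ac_poly u), to_fract (ac_poly v)) (Affine (to_ac x) (to_ac y))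
    = to_ac (poly u x + poly v x * y)"
proof -
  interpret K: weierstrass "to_ac a" "to_ac b" by (rule ac_weierstrass)
  have "to_ac (y ^ 2) = to_ac (x ^ 3 + a * x + b)" using assms by (simp only: on_curve_def)
  hence oc: "K.on_curve (to_ac x) (to_ac y)" by (simp add: K.on_curve_def)
  show ?thesis using K.ec_value_affine[OF oc] by (simp flip: K.el_conv_ffun add: K.ev_el)
qed

section \<open>The code over the base field, the group of points and zero sets\<close>

context weierstrass
begin

fun ev_pt :: "'k ec_point \<Rightarrow> 'k poly fract alg_closure \<Rightarrow> 'k" where
  "ev_pt (Affine x y) z = ev x y z"
| "ev_pt Infinity z = 0"

text \<open>The closure disappears here: \<open>RR_space\<close> is described by base polynomials,
  the points are rational, and \<open>to_ac\<close> is injective.\<close>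

lemma ag_code_iff:
  assumes P: "\<And>i. i \<in> {1..n} \<Longrightarrow> P i \<in> ec_points a b - {Infinity}"
  shows "c \<in> ag_code a b n P (\<lambda>Q. int k * point_divisor Infinity Q) \<longleftrightarrow>
    c \<in> extensional {1..n} \<and> (\<exists>z\<in>R. degree (nrm z) \<le> k \<and> (\<forall>i\<in>{1..n}. c i = ev_pt (P i) z))"
proof -
  have val: "to_ac (c i) = ec_value (to_ac a) (to_ac b) (to_fract (ac_poly u), to_fract (ac_poly v))
      (map_ec_point to_ac (P i)) \<longleftrightarrow> c i = ev_pt (P i) (el u v)" if i: "i \<in> {1..n}" for i u v
  proof -
    obtain x y where xy: "P i = Affine x y" "on_curve x y"
      using P[OF i] by (cases "P i") (auto simp: on_curve_iff)
    show ?thesis unfolding xy(1) ec_point.map ec_value_base[OF xy(2)] to_ac_eq_iff by (simp add: ev_el)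
  qed
  have "c \<in> ag_code a b n P (\<lambda>Q. int k * point_divisor Infinity Q) \<longleftrightarrow> c \<in> extensional {1..n} \<and>
    (\<exists>u v. deg_le k u v \<and> (\<forall>i\<in>{1..n}. to_ac (c i) = ec_value (to_ac a) (to_ac b)
       (to_fract (ac_poly u), to_fract (ac_poly v)) (map_ec_point to_ac (P i))))"
    unfolding ag_code_def RR_space_eq by blast
  also have "\<dots> \<longleftrightarrow> c \<in> extensional {1..n} \<and>
    (\<exists>u v. deg_le k u v \<and> (\<forall>i\<in>{1..n}. c i = ev_pt (P i) (el u v)))"
    by (simp only: val cong: ball_cong)
  also have "\<dots> \<longleftrightarrow> c \<in> extensional {1..n} \<and>
    (\<exists>z\<in>R. degree (nrm z) \<le> k \<and> (\<forall>i\<in>{1..n}. c i = ev_pt (P i) z))"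
    unfolding degree_nrm_le_iff[symmetric] by (auto elim!: R_cases)
  finally show ?thesis .
qed

lemma ec_add_closed:
  assumes "p \<in> ec_points a b" "q \<in> ec_points a b" shows "ec_add a p q \<in> ec_points a b"
proof (cases "p = Infinity \<or> q = Infinity")
  case True
  thus ?thesis using assms by (cases p; cases q) auto
next
  case False
  then obtain x1 y1 x2 y2 where pq: "p = Affine x1 y1" "q = Affine x2 y2" by (cases p; cases q) auto
  hence "on_curve x1 y1" "on_curve x2 y2" using assms by (simp_all add: on_curve_iff)
  thus ?thesis unfolding pq
    by (cases rule: ec_add_cases) (auto simp: on_curve_iff ec_points_def simp del: ec_add.simps)
qed

abbreviation "EG \<equiv> ec_group a b"

lemma EG_simps [simp]: "carrier EG = ec_points a b" "p \<otimes>\<^bsub>EG\<^esub> q = ec_add a p q" "\<one>\<^bsub>EG\<^esub> = Infinity"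
  by (simp_all add: ec_group_def)

text \<open>There is no circularity: \<open>iso\<close> asks for a multiplicative bijection only, so
  injectivity of h pulls associativity and commutativity back. Closure, unit and inverses are
  checked on the curve.\<close>

lemma comm_group_EG:
  assumes "comm_group H" "h \<in> iso EG H"
  shows "comm_group EG"
proof -
  interpret H: comm_group H by fact
  have inj: "inj_on h (ec_points a b)" and hom: "h (ec_add a p q) = h p \<otimes>\<^bsub>H\<^esub> h q"
    and car: "h p \<in> carrier H" if "p \<in> ec_points a b" "q \<in> ec_points a b" for p q
    using assms(2) that by (auto simp: iso_def hom_def bij_betw_def)
  have inj: "inj_on h (ec_points a b)" using assms(2) by (simp add: iso_def bij_betw_def)
  show ?thesis
  proof (rule comm_groupI)
    fix p q r assume pts: "p \<in> carrier EG" "q \<in> carrier EG" "r \<in> carrier EG"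
    note pts' = pts[unfolded EG_simps]
    show "p \<otimes>\<^bsub>EG\<^esub> q \<in> carrier EG" using pts' ec_add_closed by simp
    have "h (ec_add a (ec_add a p q) r) = h (ec_add a p (ec_add a q r))"
      using pts' ec_add_closed by (simp add: hom car H.m_assoc)
    thus "p \<otimes>\<^bsub>EG\<^esub> q \<otimes>\<^bsub>EG\<^esub> r = p \<otimes>\<^bsub>EG\<^esub> (q \<otimes>\<^bsub>EG\<^esub> r)"
      using inj pts' ec_add_closed by (auto dest: inj_onD)
    have "h (ec_add a p q) = h (ec_add a q p)" using pts' by (simp add: hom car H.m_comm)
    thus "p \<otimes>\<^bsub>EG\<^esub> q = q \<otimes>\<^bsub>EG\<^esub> p" using inj pts' ec_add_closed by (auto dest: inj_onD)
  next
    show "\<one>\<^bsub>EG\<^esub> \<in> carrier EG" by (simp add: ec_points_def)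
    show "\<one>\<^bsub>EG\<^esub> \<otimes>\<^bsub>EG\<^esub> p = p" if "p \<in> carrier EG" for p by simp
    show "\<exists>q\<in>carrier EG. q \<otimes>\<^bsub>EG\<^esub> p = \<one>\<^bsub>EG\<^esub>" if "p \<in> carrier EG" for p
    proof (cases p)
      case Infinity
      thus ?thesis by (auto simp: ec_points_def)
    next
      case (Affine x y)
      thus ?thesis using that by (intro bexI[of _ "Affine x (- y)"]) (auto simp: ec_points_def)
    qed
  qed
qed

text \<open>The right fold \<open>?s\<close> mediates: associativity identifies it with the
  left-associated \<open>psum\<close>, distinctness with the product over a set.\<close>

lemma psum_conv_finprod:
  assumes "comm_group EG" "distinct L" "\<forall>(x, y) \<in> set L. on_curve x y"
  shows "psum L = (\<Otimes>\<^bsub>EG\<^esub>p \<in> (\<lambda>(x, y). Affine x y) ` set L. p)"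
proof -
  interpret EG: comm_group EG by fact
  let ?s = "\<lambda>L. foldr (\<lambda>(x, y) p. ec_add a (Affine x y) p) L Infinity"
  have car: "?s L \<in> carrier EG" if "\<forall>(x, y) \<in> set L. on_curve x y" for L
    using that
  proof (induction L)
    case (Cons P L)
    obtain x y where "P = (x, y)" by fastforce
    thus ?case using Cons EG.m_closed[of "Affine x y" "?s L"]
      by (auto simp: on_curve_iff simp del: ec_add.simps)
  qed (simp add: ec_points_def)
  have assoc: "ec_add a (ec_add a p q) r = ec_add a p (ec_add a q r)"
    if "p \<in> ec_points a b" "q \<in> ec_points a b" "r \<in> ec_points a b" for p q r
    using EG.m_assoc[of p q r] that by simp
  have "psum L = ?s L" if "\<forall>(x, y) \<in> set L. on_curve x y" for L
    using that
  proof (induction L rule: psum.induct)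
    case (2 x y)
    show ?case by simp
  next
    case (3 x1 y1 x2 y2 L)
    have oc: "on_curve x1 y1" "on_curve x2 y2" using 3 by auto
    have eq: "?s ((x1, y1) # (x2, y2) # L) = ec_add a (ec_add a (Affine x1 y1) (Affine x2 y2)) (?s L)"
      using assoc[of "Affine x1 y1" "Affine x2 y2" "?s L"] car[of L] 3 by (simp add: on_curve_iff del: ec_add.simps)
    from oc show ?case
    proof (cases rule: ec_add_cases)
      case 1
      thus ?thesis unfolding eq using 3(1,3) by (simp del: foldr.simps)
    next
      case (2 m x3 y3)
      have "psum ((x3, y3) # L) = ?s ((x3, y3) # L)" by (rule 3(2)) (use 2 3(3) in auto)
      thus ?thesis unfolding eq using 2(1) by (simp del: ec_add.simps)
    qed
  qed simp
  moreover have "?s L = (\<Otimes>\<^bsub>EG\<^esub>p \<in> (\<lambda>(x, y). Affine x y) ` set L. p)"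
    using assms(2,3)
  proof (induction L)
    case (Cons P L)
    obtain x y where P: "P = (x, y)" by fastforce
    have "Affine x y \<notin> (\<lambda>(x, y). Affine x y) ` set L" using Cons P by auto
    moreover have "(\<lambda>(x, y). Affine x y) ` set L \<subseteq> carrier EG" "Affine x y \<in> carrier EG"
      using Cons P by (auto simp: on_curve_iff)
    ultimately have "(\<Otimes>\<^bsub>EG\<^esub>p \<in> insert (Affine x y) ((\<lambda>(x, y). Affine x y) ` set L). p) =
        Affine x y \<otimes>\<^bsub>EG\<^esub> (\<Otimes>\<^bsub>EG\<^esub>p \<in> (\<lambda>(x, y). Affine x y) ` set L. p)"
      by (intro EG.finprod_insert) auto
    thus ?case using Cons P by simp
  qed (simp add: EG.finprod_empty)
  ultimately show ?thesis using assms(3) by simp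
qed

text \<open>The zeros are distinct, so z lies in the product of their ideals, and card S <= degree
  <= k <= card S is a chain of equalities; the equality case of \<open>pid_degree\<close> gives the
  sum.\<close>

lemma zero_set_sum:
  assumes G: "comm_group EG" and z: "z \<in> R" "z \<noteq> 0" "degree (nrm z) \<le> k"
    and S: "finite S" "S \<subseteq> ec_points a b - {Infinity}" "\<And>p. p \<in> S \<Longrightarrow> ev_pt p z = 0" "k \<le> card S"
  shows "card S = k \<and> (\<Otimes>\<^bsub>EG\<^esub>p \<in> S. p) = Infinity"
proof -
  let ?A = "\<lambda>(x, y). Affine x y :: 'k ec_point"
  have "finite (?A -` S)" using S(1) by (rule finite_vimageI) (auto intro: injI)
  then obtain L where L: "set L = ?A -` S" "distinct L" using finite_distinct_list by blast
  have AS: "?A ` set L = S" unfolding L(1)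
  proof (rule image_vimage_eq[THEN trans], safe)
    fix p assume "p \<in> S"
    thus "p \<in> range ?A" using S(2) by (cases p) (auto simp: image_iff)
  qed
  have oc: "\<forall>(x, y)\<in>set L. on_curve x y" using S(2) L by (auto simp: on_curve_iff)
  have "z \<in> pid L" using S(3) L oc z(1) by (intro pid_distinctI) (force simp flip: ev_pt.simps)+
  hence len: "length L \<le> degree (nrm z)" "length L = degree (nrm z) \<longrightarrow> psum L = Infinity"
    using pid_degree[OF _ z(2) oc] by auto
  have "card S = card (?A ` set L)" unfolding AS ..
  also have "\<dots> = card (set L)" by (rule card_image) (auto intro: inj_onI)
  finally have "length L = card S" using distinct_card[OF L(2)] by simp
  hence "card S = k" "psum L = Infinity" using len z(3) S(4) by auto
  thus ?thesis using psum_conv_finprod[OF G L(2) oc] unfolding AS by simp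
qed

text \<open>A zero outside S would give card S + 1 zeros to a function of degree card S, against
  \<open>zero_set_sum\<close>.\<close>

lemma zero_set_exists:
  assumes G: "comm_group EG"
    and S: "finite S" "S \<subseteq> ec_points a b - {Infinity}" "(\<Otimes>\<^bsub>EG\<^esub>p \<in> S. p) = Infinity"
  obtains z where "z \<in> R" "degree (nrm z) \<le> card S"
    "\<And>p. p \<in> ec_points a b - {Infinity} \<Longrightarrow> ev_pt p z = 0 \<longleftrightarrow> p \<in> S"
proof -
  let ?A = "\<lambda>(x, y). Affine x y :: 'k ec_point"
  have "finite (?A -` S)" using S(1) by (rule finite_vimageI) (auto intro: injI)
  then obtain L where L: "set L = ?A -` S" "distinct L" using finite_distinct_list by blast
  have AS: "?A ` set L = S" unfolding L(1)
  proof (rule image_vimage_eq[THEN trans], safe)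
    fix p assume "p \<in> S"
    thus "p \<in> range ?A" using S(2) by (cases p) (auto simp: image_iff)
  qed
  have oc: "\<forall>(x, y)\<in>set L. on_curve x y" using S(2) L by (auto simp: on_curve_iff)
  have "card S = card (?A ` set L)" unfolding AS ..
  also have "\<dots> = card (set L)" by (rule card_image) (auto intro: inj_onI)
  finally have len: "length L = card S" using distinct_card[OF L(2)] by simp
  have "psum L = Infinity" using psum_conv_finprod[OF G L(2) oc] S(3) unfolding AS by simp
  then obtain z where z: "z \<in> pid L" "z \<noteq> 0" "degree (nrm z) = length L" using pid_exists[OF _ oc] by blast
  have zR: "z \<in> R" using z(1) by (rule pid_sub_R)
  have zS: "ev_pt p z = 0" if pS: "p \<in> S" for p
  proof -
    obtain x y where "p = Affine x y" using pS S(2) by (cases p) auto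
    thus ?thesis using ev_pid[OF z(1) _ oc, of x y] pS L(1) by auto
  qed
  have "p \<in> S" if p: "p \<in> ec_points a b - {Infinity}" "ev_pt p z = 0" for p
  proof (rule ccontr)
    assume "p \<notin> S"
    moreover have "card (insert p S) = card S"
      by (rule conjunct1[OF zero_set_sum[OF G zR z(2)]])
        (use z(3) len S(1,2) p zS \<open>p \<notin> S\<close> in auto)
    ultimately show False using S(1) by simp
  qed
  thus ?thesis using that[OF zR] z(3) len zS by (metis order_refl)
qed

end

section \<open>Transport along the isomorphism and the supports of minimum weight\<close>

lemma hom_finprod_image:
  assumes "comm_group G" "comm_group H" and h: "h \<in> hom G H" "inj_on h (carrier G)"
    and S: "finite S" "S \<subseteq> carrier G"
  shows "h (\<Otimes>\<^bsub>G\<^esub>x\<in>S. x) = (\<Otimes>\<^bsub>H\<^esub>y\<in>h ` S. y)"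
proof -
  interpret G: comm_group G by fact
  interpret H: comm_group H by fact
  have "h \<one>\<^bsub>G\<^esub> = \<one>\<^bsub>H\<^esub>" using h(1) G.is_group H.is_group by (rule hom_one)
  have car: "h x \<in> carrier H" if "x \<in> carrier G" for x using h(1) that by (auto simp: hom_def)
  show ?thesis
    using S
  proof (induction S rule: finite_induct)
    case empty
    show ?case using \<open>h \<one>\<^bsub>G\<^esub> = \<one>\<^bsub>H\<^esub>\<close> by simp
  next
    case (insert x S)
    have x: "x \<in> carrier G" "S \<subseteq> carrier G" "(\<lambda>x. x) \<in> S \<rightarrow> carrier G" using insert by auto
    have "h x \<notin> h ` S" using insert h(2) x by (auto dest: inj_onD)
    hence "(\<Otimes>\<^bsub>H\<^esub>y\<in>h ` insert x S. y) = h x \<otimes>\<^bsub>H\<^esub> (\<Otimes>\<^bsub>H\<^esub>y\<in>h ` S. y)"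
      unfolding image_insert using insert(1) x car by (intro H.finprod_insert) auto
    also have "\<dots> = h x \<otimes>\<^bsub>H\<^esub> h (\<Otimes>\<^bsub>G\<^esub>x\<in>S. x)" using insert x by simp
    also have "\<dots> = h (x \<otimes>\<^bsub>G\<^esub> (\<Otimes>\<^bsub>G\<^esub>x\<in>S. x))"
      using h(1) x G.finprod_closed[OF x(3)] by (simp add: hom_def)
    also have "x \<otimes>\<^bsub>G\<^esub> (\<Otimes>\<^bsub>G\<^esub>x\<in>S. x) = (\<Otimes>\<^bsub>G\<^esub>x\<in>insert x S. x)"
      using insert(1,2) x by (intro G.finprod_insert[symmetric]) auto
    finally show ?case by simp
  qed
qed

lemma comm_group_DirProd:
  assumes "comm_group G" "comm_group H" shows "comm_group (G \<times>\<times> H)"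
proof -
  interpret G: comm_group G by fact
  interpret H: comm_group H by fact
  interpret GH: group "G \<times>\<times> H" by (rule DirProd_group) unfold_locales
  show ?thesis by (rule GH.group_comm_groupI) (auto simp: G.m_comm H.m_comm)
qed

context weierstrass
begin

text \<open>A word of weight n - k vanishes at exactly k of the points, and h carries this zero set
  to a block; the excluded point O becomes the condition that the block avoids the identity.\<close>

lemma code_supports_eq:
  assumes H: "comm_group H" and h: "h \<in> iso EG H" and fin: "finite (ec_points a b)"
    and P: "bij_betw P {1..n} (ec_points a b - {Infinity})" and k: "k < n"
  shows "code_supports n (n - k) (ag_code a b n P (\<lambda>Q. int k * point_divisor Infinity Q)) =
    {{i \<in> {1..n}. h (P i) \<notin> B} | B. B \<in> zero_sum_subsets H k \<and> \<one>\<^bsub>H\<^esub> \<notin> B}"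
proof -
  interpret H: comm_group H by fact
  have G: "comm_group EG" using H h by (rule comm_group_EG)
  interpret G: comm_group EG by (rule G)
  let ?E = "ec_points a b - {Infinity}"
  have Inf: "Infinity \<in> ec_points a b" by (simp add: ec_points_def)
  have hom: "h \<in> hom EG H" and inj: "inj_on h (ec_points a b)" and surj: "h ` ec_points a b = carrier H"
    using h by (auto simp: iso_def bij_betw_def)
  have h1: "h Infinity = \<one>\<^bsub>H\<^esub>" using hom_one[OF hom G.is_group H.is_group] by simp
  have hsum: "h (\<Otimes>\<^bsub>EG\<^esub>p\<in>S. p) = (\<Otimes>\<^bsub>H\<^esub>y\<in>h ` S. y)" if "S \<subseteq> ?E" for S
    using hom_finprod_image[OF G H hom] inj that fin finite_subset[of S "ec_points a b"] by auto
  have Pi: "P i \<in> ?E" if "i \<in> {1..n}" for i by (rule bij_betwE[OF P, rule_format, OF that])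
  have injP: "inj_on P {1..n}" and imP: "P ` {1..n} = ?E" using P by (auto simp: bij_betw_def)
  have mem: "h p \<in> h ` S \<longleftrightarrow> p \<in> S" if "p \<in> ec_points a b" "S \<subseteq> ec_points a b" for p S
    using inj that by (auto dest: inj_onD)
  have compl: "card A + card ({1..n} - A) = n" if "A \<subseteq> {1..n}" for A
    using that card_mono[OF _ that] finite_subset[OF that] by (simp add: card_Diff_subset)
  show ?thesis
  proof (intro equalityI subsetI)
    fix T assume "T \<in> code_supports n (n - k) (ag_code a b n P (\<lambda>Q. int k * point_divisor Infinity Q))"
    then obtain c where c: "c \<in> ag_code a b n P (\<lambda>Q. int k * point_divisor Infinity Q)"
      "T = word_support n c" "card (word_support n c) = n - k" by (auto simp: code_supports_def)
    obtain z where z: "z \<in> R" "degree (nrm z) \<le> k" "\<forall>i\<in>{1..n}. c i = ev_pt (P i) z"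
      using c(1) ag_code_iff[of n P, OF Pi] by blast
    have ev0: "ev_pt p 0 = 0" for p by (cases p) auto
    \<comment> \<open>The weight n - k is positive because k < n, which excludes the zero
      function.\<close>
    have "z \<noteq> 0"
    proof
      assume "z = 0"
      hence "word_support n c = {}" using z(3) ev0 by (auto simp: word_support_def)
      thus False using c(3) k by simp
    qed
    define Z where "Z = {i \<in> {1..n}. c i = 0}"
    define S where "S = P ` Z"
    have "T = {1..n} - Z" unfolding c(2) by (auto simp: word_support_def Z_def)
    moreover have "Z \<subseteq> {1..n}" by (auto simp: Z_def)
    ultimately have "card Z + card T = n" using compl by blast
    hence "card Z = k" using c(2,3) k by simp
    have "card (P ` Z) = card Z" using injP by (rule card_image[OF inj_on_subset]) (auto simp: Z_def)
    hence S: "finite S" "S \<subseteq> ?E" "card S = k"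
      using Pi \<open>card Z = k\<close> by (auto simp: S_def Z_def)
    have ev: "ev_pt p z = 0" if "p \<in> S" for p using that z(3) by (auto simp: S_def Z_def)
    have sum: "(\<Otimes>\<^bsub>EG\<^esub>p\<in>S. p) = Infinity"
      using zero_set_sum[OF G z(1) \<open>z \<noteq> 0\<close> z(2) S(1,2) ev] S(3) by simp
    have "card (h ` S) = k" using S card_image[OF inj_on_subset[OF inj, of S]] by auto
    hence B: "h ` S \<in> zero_sum_subsets H k"
      using hsum[OF S(2)] sum h1 S(2) surj by (auto simp: zero_sum_subsets_def)
    have one: "\<one>\<^bsub>H\<^esub> \<notin> h ` S" unfolding h1[symmetric] using mem[OF Inf, of S] S(2) by auto
    have iS: "h (P i) \<notin> h ` S \<longleftrightarrow> c i \<noteq> 0" if "i \<in> {1..n}" for i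
    proof -
      have "h (P i) \<in> h ` S \<longleftrightarrow> P i \<in> S" using mem[of "P i" S] Pi[OF that] S(2) by blast
      also have "\<dots> \<longleftrightarrow> i \<in> Z"
        unfolding S_def by (rule inj_on_image_mem_iff[OF injP that]) (auto simp: Z_def)
      finally show ?thesis using that by (simp add: Z_def)
    qed
    have "T = {i \<in> {1..n}. h (P i) \<notin> h ` S}" unfolding c(2) word_support_def using iS by blast
    thus "T \<in> {{i \<in> {1..n}. h (P i) \<notin> B} | B. B \<in> zero_sum_subsets H k \<and> \<one>\<^bsub>H\<^esub> \<notin> B}"
      using B one by blast
  next
    fix T assume "T \<in> {{i \<in> {1..n}. h (P i) \<notin> B} | B. B \<in> zero_sum_subsets H k \<and> \<one>\<^bsub>H\<^esub> \<notin> B}"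
    then obtain B where T: "T = {i \<in> {1..n}. h (P i) \<notin> B}" and B: "B \<in> zero_sum_subsets H k" "\<one>\<^bsub>H\<^esub> \<notin> B"
      by blast
    \<comment> \<open>The preimage of the block. It consists of affine points because the identity,
      the image of \<open>Infinity\<close>, is not in \<open>B\<close>.\<close>
    define S where "S = {p \<in> ec_points a b. h p \<in> B}"
    have BH: "B \<subseteq> carrier H" "card B = k" "(\<Otimes>\<^bsub>H\<^esub>y\<in>B. y) = \<one>\<^bsub>H\<^esub>" using B(1) by (auto simp: zero_sum_subsets_def)
    have hS: "h ` S = B" using surj BH(1) by (auto simp: S_def)
    have S: "S \<subseteq> ?E" "finite S" using B(2) h1 fin by (auto simp: S_def)
    have "card (h ` S) = card S" by (rule card_image, rule inj_on_subset[OF inj]) (auto simp: S_def)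
    hence cS: "card S = k" using hS BH by simp
    have "h (\<Otimes>\<^bsub>EG\<^esub>p\<in>S. p) = h Infinity" using hsum[OF S(1)] hS BH(3) h1 by simp
    moreover have "(\<Otimes>\<^bsub>EG\<^esub>p\<in>S. p) \<in> carrier EG" using S(1) by (intro G.finprod_closed) auto
    ultimately have sum: "(\<Otimes>\<^bsub>EG\<^esub>p\<in>S. p) = Infinity" using inj_onD[OF inj] Inf by simp
    obtain z where z: "z \<in> R" "degree (nrm z) \<le> card S" "\<And>p. p \<in> ?E \<Longrightarrow> ev_pt p z = 0 \<longleftrightarrow> p \<in> S"
      using zero_set_exists[OF G S(2,1) sum] by metis
    define c where "c = restrict (\<lambda>i. ev_pt (P i) z) {1..n}"
    have c: "c \<in> ag_code a b n P (\<lambda>Q. int k * point_divisor Infinity Q)"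
      using ag_code_iff[of n P c k, OF Pi] z(1,2) cS by (auto simp: c_def)
    have "c i \<noteq> 0 \<longleftrightarrow> h (P i) \<notin> B" if "i \<in> {1..n}" for i
      using that z(3)[OF Pi[OF that]] Pi[OF that] by (auto simp: c_def S_def)
    hence T': "T = word_support n c" unfolding T word_support_def by blast
    have "P ` ({1..n} - T) = S"
    proof -
      have "P ` ({1..n} - T) = {p \<in> P ` {1..n}. h p \<in> B}" unfolding T by blast
      also have "\<dots> = S" unfolding imP using S(1) by (auto simp: S_def)
      finally show ?thesis .
    qed
    hence "card ({1..n} - T) = k" using cS card_image[OF inj_on_subset[OF injP, of "{1..n} - T"]] by auto
    moreover have "T \<subseteq> {1..n}" unfolding T by auto
    ultimately have "card T = n - k" using compl[of T] by simp
    thus "T \<in> code_supports n (n - k) (ag_code a b n P (\<lambda>Q. int k * point_divisor Infinity Q))"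
      unfolding code_supports_def using c T' by auto
  qed
qed

end

theorem theorem7:
  fixes a b :: "'a::{field,finite}"
    and n1 n2 n k t lam :: nat
    and P :: "nat \<Rightarrow> 'a ec_point"
  assumes "CHAR('a) \<noteq> 2" "CHAR('a) \<noteq> 3"
    and "ec_nonsingular a b"
    and "ec_group a b \<cong> integer_mod_group n1 \<times>\<times> integer_mod_group n2"
    and "1 < n1" "n1 dvd n2"
    and "n = n1 * n2 - 1"
    and "bij_betw P {1..n} (ec_points a b - {Infinity})"
    and "1 \<le> k" "k \<le> n - 1"
    and "1 \<le> t"
    and "n2 dvd k"
    and "t_design (t + 1) (n + 1) k lam
           (carrier (integer_mod_group n1 \<times>\<times> integer_mod_group n2))
           (zero_sum_subsets (integer_mod_group n1 \<times>\<times> integer_mod_group n2) k)"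
  shows "\<exists>mu. t_design t n (n - k) mu {1..n}
           (code_supports n (n - k)
             (ag_code a b n P (\<lambda>Q. int k * point_divisor Infinity Q)))"
proof -
  let ?H = "integer_mod_group n1 \<times>\<times> integer_mod_group n2"
  have "(2::'a) \<noteq> 0"
  proof
    assume "(2::'a) = 0"
    hence "CHAR('a) dvd 2" using of_nat_eq_0_iff_char_dvd[of 2, where 'a = 'a] by simp
    hence "CHAR('a) \<in> {1, 2}" using prime_nat_iff[of 2] two_is_prime_nat by blast
    thus False using assms(1) CHAR_not_1'[where 'a = 'a] by auto
  qed
  then interpret weierstrass a b using assms(3) by unfold_locales
  obtain h where h: "h \<in> iso EG ?H" using assms(4) by (auto simp: is_iso_def)
  have H: "comm_group ?H" by (intro comm_group_DirProd abelian_integer_mod_group)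
  interpret H: comm_group ?H by (rule H)
  have bij: "bij_betw h (ec_points a b) (carrier ?H)" using h by (simp add: iso_def)
  have finH: "finite (carrier ?H)" using assms(13) by (simp add: t_design_def)
  hence fin: "finite (ec_points a b)" using bij bij_betw_finite by blast
  \<comment> \<open>For n2 = 0 truncated subtraction would give n = 0, leaving no k with 1 <= k <= n
    - 1.\<close>
  have "0 < n2" using assms(5-7,9,10) by (intro Nat.gr0I) auto
  hence two_torsion: "card {w \<in> carrier ?H. w \<otimes>\<^bsub>?H\<^esub> w = s} \<le> 4" for s
    using assms(5) by (intro card_integer_mod_prod_double) auto
  have "h Infinity = \<one>\<^bsub>?H\<^esub>"
    using hom_one[of h EG ?H] h comm_group.axioms(2)[OF comm_group_EG[OF H h]] H.is_group by (simp add: iso_def)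
  moreover have "Infinity \<in> ec_points a b" by (simp add: ec_points_def)
  ultimately have "bij_betw h (ec_points a b - {Infinity}) (carrier ?H - {\<one>\<^bsub>?H\<^esub>})"
    using bij_betw_DiffI[OF bij, of "{Infinity}" "{\<one>\<^bsub>?H\<^esub>}"] by simp
  hence \<phi>: "bij_betw (\<lambda>i. h (P i)) {1..n} (carrier ?H - {\<one>\<^bsub>?H\<^esub>})"
    using bij_betw_trans[OF assms(8)] by (simp add: comp_def)
  have "k < n" using assms(9,10) by linarith
  have "t \<le> n - k" by (rule H.zero_sum_design_bound[OF finH two_torsion assms(13,9,10)])
  from t_design_complement_residual[OF assms(13) H.one_closed \<phi> this]
  show ?thesis unfolding code_supports_eq[OF H h fin assms(8) \<open>k < n\<close>] .
qed

end
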